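(* Let $G = (V, E, \vec{W})$ be a graph with $n$ vertices and $m$ edges, and let $\varepsilon, \delta > 0$. Consider an arbitrary (non-private) algorithm that computes a minimum spanning tree of $G$ within time $t(n,m)$, independent of the weight vector. Then there exists an $(\varepsilon, \delta)$-differentially private mechanism $\mathcal{M}$ that releases a random, approximately minimum spanning tree $\mathcal{M}(G)$ such that, if $T^*$ is a minimum spanning tree of $G$: (i) the weight difference satisfies $\mathbb{E}\left[\sum_{e \in \mathcal{M}(G)} w_e\right] - \sum_{e\in T^*} w_e \in O\left(\frac{1}{\varepsilon} \cdot n^{3/2} \cdot \log n \cdot \sqrt{\log(1/\delta)}\right)$, and (ii) the running time of $\mathcal{M}$ is $t(n,m) + O(m)$.
   Context: A graph $G = (V, E, \vec{W})$ has public vertex set $V = \{1,\dots,n\}$, public undirected edge set $E = \{1,\dots,m\}$, and private weight vector $\vec{W} = (w_1,\dots,w_m) \in \mathbb{R}^m$. For $T \subseteq E$, $w(T) = \sum_{e\in T} w_e$; a minimum spanning tree is a spanning tree minimizing $w(T)$. Two graphs $G=(V,E,\vec{W})$ and $G'=(V',E',\vec{W}')$ are neighboring if $V=V'$, $E=E'$ and $\|\vec{W}-\vec{W}'\|_\infty = \max_{e\in E}|w_e - w'_e| \le 1$. A randomized algorithm $\mathcal{M}$ outputting spanning trees is $(\varepsilon,\delta)$-differentially private if for all neighboring $G, G'$ and every set $Z$ of spanning trees, $\Pr[\mathcal{M}(G)\in Z] \le e^{\varepsilon}\Pr[\mathcal{M}(G')\in Z] + \delta$.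
   Formalization: Requires δ < 1, and the O-constant in (i) is uniform only for ε ≤ K·log(1/δ), depending on K; a single constant for all ε, δ is impossible (e.g. δ = 1/4, ε = n^0.6 on a chain of triangles). *)

theory Defs
  imports "HOL-Probability.Probability"
begin

section \<open>Graphs, spanning trees, neighbouring weights\<close>

text \<open>
  A topology is the public part of a graph: vertices \<open>1, \<dots>, n\<close> and edges \<open>1, \<dots>, m\<close>, edge \<open>e\<close>
  joining the two components of entry \<open>e - 1\<close> of the list (their order carries no meaning).
  Weights are kept separate, as functions of which only the values on \<open>1, \<dots>, m\<close> matter.
\<close>

record topology =
  nverts :: nat
  ends_list :: "(nat \<times> nat) list"

definition nedges :: "topology \<Rightarrow> nat" where
  "nedges G = length (ends_list G)"

definition verts :: "topology \<Rightarrow> nat set" where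
  "verts G = {1..nverts G}"

definition edges :: "topology \<Rightarrow> nat set" where
  "edges G = {1..nedges G}"

definition end1 :: "topology \<Rightarrow> nat \<Rightarrow> nat" where
  "end1 G e = fst (ends_list G ! (e - 1))"

definition end2 :: "topology \<Rightarrow> nat \<Rightarrow> nat" where
  "end2 G e = snd (ends_list G ! (e - 1))"

definition ends :: "topology \<Rightarrow> nat \<Rightarrow> nat set" where
  "ends G e = {end1 G e, end2 G e}"

definition simple_graph :: "topology \<Rightarrow> bool" where
  "simple_graph G \<longleftrightarrow>
     (\<forall>e\<in>edges G. ends G e \<subseteq> verts G \<and> end1 G e \<noteq> end2 G e) \<and>
     inj_on (ends G) (edges G)"

definition adj :: "topology \<Rightarrow> nat set \<Rightarrow> (nat \<times> nat) set" where
  "adj G T = {(u, v). \<exists>e\<in>T. ends G e = {u, v}}"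

definition connects :: "topology \<Rightarrow> nat set \<Rightarrow> bool" where
  "connects G T \<longleftrightarrow> (\<forall>u\<in>verts G. \<forall>v\<in>verts G. (u, v) \<in> (adj G T)\<^sup>*)"

text \<open>A cycle in a simple graph, given by its cyclic sequence of distinct vertices.\<close>

definition is_cycle :: "topology \<Rightarrow> nat set \<Rightarrow> nat list \<Rightarrow> bool" where
  "is_cycle G T vs \<longleftrightarrow> 3 \<le> length vs \<and> distinct vs \<and>
     (\<forall>i<length vs. (vs ! i, vs ! (Suc i mod length vs)) \<in> adj G T)"

definition spanning_tree :: "topology \<Rightarrow> nat set \<Rightarrow> bool" where
  "spanning_tree G T \<longleftrightarrow> T \<subseteq> edges G \<and> connects G T \<and> (\<nexists>vs. is_cycle G T vs)"

definition connected_graph :: "topology \<Rightarrow> bool" where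
  "connected_graph G \<longleftrightarrow> 1 \<le> nverts G \<and> simple_graph G \<and> connects G (edges G)"

definition weight :: "(nat \<Rightarrow> real) \<Rightarrow> nat set \<Rightarrow> real" where
  "weight w T = (\<Sum>e\<in>T. w e)"

definition minimum_spanning_tree :: "topology \<Rightarrow> (nat \<Rightarrow> real) \<Rightarrow> nat set \<Rightarrow> bool" where
  "minimum_spanning_tree G w T \<longleftrightarrow>
     spanning_tree G T \<and> (\<forall>T'. spanning_tree G T' \<longrightarrow> weight w T \<le> weight w T')"

text \<open>The \<open>0\<close> only serves to make the maximum over an empty edge set equal to \<open>0\<close>.\<close>

definition linf_dist :: "topology \<Rightarrow> (nat \<Rightarrow> real) \<Rightarrow> (nat \<Rightarrow> real) \<Rightarrow> real" where
  "linf_dist G w w' = Max (insert 0 ((\<lambda>e. \<bar>w e - w' e\<bar>) ` edges G))"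

definition neighboring :: "topology \<Rightarrow> (nat \<Rightarrow> real) \<Rightarrow> (nat \<Rightarrow> real) \<Rightarrow> bool" where
  "neighboring G w w' \<longleftrightarrow> linf_dist G w w' \<le> 1"


section \<open>Algorithms: a unit-cost randomized real RAM\<close>

text \<open>
  The machine has a finite program, natural-number and real registers, and two memories
  (one of naturals, one of reals) that are indirectly addressed through natural-number registers.
  There is no conversion from reals to naturals: reals influence control flow only through
  comparisons. Each instruction costs one time unit, including drawing an independent uniform
  sample from \<open>[0,1]\<close>.
\<close>

datatype arith = Plus | Minus | Times | Divide

datatype elementary = Ln | Exp | Sqrt

datatype instr =
    NConst nat nat             \<comment> \<open>\<open>n[x] := k\<close>\<close>
  | NArith arith nat nat nat   \<comment> \<open>\<open>n[x] := n[y] \<circ> n[z]\<close>; subtraction and division are those of \<open>nat\<close>\<close>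
  | NLoad nat nat              \<comment> \<open>\<open>n[x] := N[n[y]]\<close>\<close>
  | NStore nat nat             \<comment> \<open>\<open>N[n[x]] := n[y]\<close>\<close>
  | RConst nat real            \<comment> \<open>\<open>r[x] := a\<close>\<close>
  | RArith arith nat nat nat   \<comment> \<open>\<open>r[x] := r[y] \<circ> r[z]\<close>\<close>
  | RElem elementary nat nat   \<comment> \<open>\<open>r[x] := f r[y]\<close>\<close>
  | ROfNat nat nat             \<comment> \<open>\<open>r[x] := n[y]\<close>\<close>
  | RLoad nat nat              \<comment> \<open>\<open>r[x] := R[n[y]]\<close>\<close>
  | RStore nat nat             \<comment> \<open>\<open>R[n[x]] := r[y]\<close>\<close>
  | Sample nat                 \<comment> \<open>\<open>r[x] :=\<close> next random number\<close>
  | Jump nat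
  | JumpNLess nat nat nat      \<comment> \<open>if \<open>n[x] < n[y]\<close>, jump to \<open>l\<close>\<close>
  | JumpRLess nat nat nat      \<comment> \<open>if \<open>r[x] < r[y]\<close>, jump to \<open>l\<close>\<close>

type_synonym program = "instr list"

record config =
  pc :: nat
  nreg :: "nat \<Rightarrow> nat"
  rreg :: "nat \<Rightarrow> real"
  nmem :: "nat \<Rightarrow> nat"
  rmem :: "nat \<Rightarrow> real"
  draws :: nat                 \<comment> \<open>number of random numbers consumed so far\<close>

fun narith :: "arith \<Rightarrow> nat \<Rightarrow> nat \<Rightarrow> nat" where
  "narith Plus a b = a + b"
| "narith Minus a b = a - b"
| "narith Times a b = a * b"
| "narith Divide a b = a div b"

fun rarith :: "arith \<Rightarrow> real \<Rightarrow> real \<Rightarrow> real" where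
  "rarith Plus a b = a + b"
| "rarith Minus a b = a - b"
| "rarith Times a b = a * b"
| "rarith Divide a b = a / b"

fun elem_fun :: "elementary \<Rightarrow> real \<Rightarrow> real" where
  "elem_fun Ln = ln"
| "elem_fun Exp = exp"
| "elem_fun Sqrt = sqrt"

definition next_pc :: "config \<Rightarrow> config" where
  "next_pc s = s\<lparr>pc := Suc (pc s)\<rparr>"

fun exec :: "(nat \<Rightarrow> real) \<Rightarrow> instr \<Rightarrow> config \<Rightarrow> config" where
  "exec \<omega> (NConst x k) s = next_pc (s\<lparr>nreg := (nreg s)(x := k)\<rparr>)"
| "exec \<omega> (NArith f x y z) s =
     next_pc (s\<lparr>nreg := (nreg s)(x := narith f (nreg s y) (nreg s z))\<rparr>)"
| "exec \<omega> (NLoad x y) s = next_pc (s\<lparr>nreg := (nreg s)(x := nmem s (nreg s y))\<rparr>)"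
| "exec \<omega> (NStore x y) s = next_pc (s\<lparr>nmem := (nmem s)(nreg s x := nreg s y)\<rparr>)"
| "exec \<omega> (RConst x a) s = next_pc (s\<lparr>rreg := (rreg s)(x := a)\<rparr>)"
| "exec \<omega> (RArith f x y z) s =
     next_pc (s\<lparr>rreg := (rreg s)(x := rarith f (rreg s y) (rreg s z))\<rparr>)"
| "exec \<omega> (RElem f x y) s = next_pc (s\<lparr>rreg := (rreg s)(x := elem_fun f (rreg s y))\<rparr>)"
| "exec \<omega> (ROfNat x y) s = next_pc (s\<lparr>rreg := (rreg s)(x := real (nreg s y))\<rparr>)"
| "exec \<omega> (RLoad x y) s = next_pc (s\<lparr>rreg := (rreg s)(x := rmem s (nreg s y))\<rparr>)"
| "exec \<omega> (RStore x y) s = next_pc (s\<lparr>rmem := (rmem s)(nreg s x := rreg s y)\<rparr>)"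
| "exec \<omega> (Sample x) s =
     next_pc (s\<lparr>rreg := (rreg s)(x := \<omega> (draws s)), draws := Suc (draws s)\<rparr>)"
| "exec \<omega> (Jump l) s = s\<lparr>pc := l\<rparr>"
| "exec \<omega> (JumpNLess x y l) s = (if nreg s x < nreg s y then s\<lparr>pc := l\<rparr> else next_pc s)"
| "exec \<omega> (JumpRLess x y l) s = (if rreg s x < rreg s y then s\<lparr>pc := l\<rparr> else next_pc s)"

text \<open>The machine halts when the program counter leaves the program.\<close>

definition halted :: "program \<Rightarrow> config \<Rightarrow> bool" where
  "halted p s \<longleftrightarrow> length p \<le> pc s"

definition step :: "program \<Rightarrow> (nat \<Rightarrow> real) \<Rightarrow> config \<Rightarrow> config" where
  "step p \<omega> s = (if halted p s then s else exec \<omega> (p ! pc s) s)"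

text \<open>
  Input: \<open>N[0] = n\<close>, \<open>N[1] = m\<close>, the ends of edge \<open>e\<close> are in \<open>N[2e]\<close> and \<open>N[2e+1]\<close>, and its weight
  is in \<open>R[e]\<close>; everything else is zero.
\<close>

definition initial :: "topology \<Rightarrow> (nat \<Rightarrow> real) \<Rightarrow> config" where
  "initial G w =
     \<lparr>pc = 0, nreg = (\<lambda>_. 0), rreg = (\<lambda>_. 0),
      nmem = (\<lambda>a. if a = 0 then nverts G
                   else if a = 1 then nedges G
                   else if a div 2 \<in> edges G
                        then (if even a then end1 G (a div 2) else end2 G (a div 2))
                   else 0),
      rmem = (\<lambda>e. if e \<in> edges G then w e else 0),
      draws = 0\<rparr>"

definition run :: "program \<Rightarrow> topology \<Rightarrow> (nat \<Rightarrow> real) \<Rightarrow> (nat \<Rightarrow> real) \<Rightarrow> nat \<Rightarrow> config" where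
  "run p G w \<omega> k = (step p \<omega> ^^ k) (initial G w)"

definition halts_within ::
    "program \<Rightarrow> topology \<Rightarrow> (nat \<Rightarrow> real) \<Rightarrow> (nat \<Rightarrow> real) \<Rightarrow> nat \<Rightarrow> bool" where
  "halts_within p G w \<omega> k \<longleftrightarrow> halted p (run p G w \<omega> k)"

text \<open>
  Output: a list of edges, its length in \<open>N[0]\<close> and its entries in \<open>N[1], N[2], \<dots>\<close>
  (meaningful for halting runs only).
\<close>

definition tree_output :: "program \<Rightarrow> topology \<Rightarrow> (nat \<Rightarrow> real) \<Rightarrow> (nat \<Rightarrow> real) \<Rightarrow> nat set" where
  "tree_output p G w \<omega> =
     (let s = run p G w \<omega> (LEAST k. halts_within p G w \<omega> k) in nmem s ` {1..nmem s 0})"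

text \<open>The sequence of random numbers: independent, uniform on \<open>[0,1]\<close>.\<close>

definition coins :: "(nat \<Rightarrow> real) measure" where
  "coins = PiM UNIV (\<lambda>_. restrict_space lborel {0..1})"

text \<open>
  Algorithms may be randomized, but must be correct and respect the time bound for all outcomes
  of the random choices; deterministic algorithms are those without \<^const>\<open>Sample\<close>.
\<close>

definition computes_mst_within :: "program \<Rightarrow> (nat \<Rightarrow> nat \<Rightarrow> nat) \<Rightarrow> bool" where
  "computes_mst_within A t \<longleftrightarrow>
     (\<forall>G w. \<forall>\<omega>\<in>space coins. connected_graph G \<longrightarrow>
        halts_within A G w \<omega> (t (nverts G) (nedges G)) \<and>
        minimum_spanning_tree G w (tree_output A G w \<omega>))"


section \<open>Mechanisms and differential privacy\<close>

text \<open>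
  Measurability of the output is part of the notion, so that \<open>release\<close> below is the genuine
  output distribution (a probability measure).
\<close>

definition spanning_tree_mechanism :: "program \<Rightarrow> bool" where
  "spanning_tree_mechanism M \<longleftrightarrow>
     (\<forall>G w. connected_graph G \<longrightarrow>
        tree_output M G w \<in> measurable coins (count_space UNIV) \<and>
        (\<forall>\<omega>\<in>space coins. (\<exists>k. halts_within M G w \<omega> k) \<and> spanning_tree G (tree_output M G w \<omega>)))"

definition release :: "program \<Rightarrow> topology \<Rightarrow> (nat \<Rightarrow> real) \<Rightarrow> nat set measure" where
  "release M G w = distr coins (count_space UNIV) (tree_output M G w)"

definition differentially_private :: "real \<Rightarrow> real \<Rightarrow> program \<Rightarrow> bool" where
  "differentially_private \<epsilon> \<delta> M \<longleftrightarrow>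
     (\<forall>G w w' Z. connected_graph G \<longrightarrow> neighboring G w w' \<longrightarrow> Z \<subseteq> {T. spanning_tree G T} \<longrightarrow>
        measure (release M G w) Z \<le> exp \<epsilon> * measure (release M G w') Z + \<delta>)"

end

theory Submission
  imports Defs "HOL-Combinatorics.Multiset_Permutations"
begin

text \<open>
  The mechanism adds \<open>\<sigma> ln (- ln U)\<close> to every weight, with \<open>U\<close> uniform and \<open>\<sigma>\<close> of order
  \<open>sqrt (n ln (1/\<delta>)) / \<epsilon>\<close>, and runs the given algorithm on the result. Up to the monotone map
  \<open>x \<mapsto> \<sigma> ln x\<close> the perturbed weights are independent exponential clocks with rates
  \<open>exp (- w e / \<sigma>)\<close>, so that their order follows the Plackett--Luce law. The minimum spanning tree
  is the greedy tree for this order, and by the memorylessness of the clocks each edge accepted by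
  the greedy algorithm is drawn by an exponential mechanism from the edges that do not close a
  cycle. Since at most \<open>n\<close> draws take place, a bound on their Renyi moments composes to
  \<open>(\<epsilon>, \<delta>)\<close>-differential privacy. The error is at most the total noise on two spanning trees,
  hence of order \<open>\<sigma> n ln n\<close>.
\<close>

section \<open>Spanning trees and greedy selection\<close>

text \<open>A neighbour may change all m weights, so charging every noisy weight would call for
  noise of order sqrt m. Only accepted edges are charged here: each of them lowers the number of
  components, which starts at n, and this puts sqrt n into \<sigma>. Memorylessness is essential
  because a single batch of noise, added in time O(m) before the given algorithm starts, has to act
  like fresh noise for every accepted edge. The given algorithm is a black box that may break ties
  at will and even draw random numbers of its own. Its output is pinned down where all noisy weights
  differ, as the minimum spanning tree is then unique; ties are ruled out by counting, since the
  probabilities of the strict orders already add up to 1. With L = ln (1/\<delta>), the hypothesis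
  \<epsilon> \<le> K L bounds the order \<alpha> = 1 + 2 L / \<epsilon> of the moments by (K + 2) L
  / \<epsilon>; hence the factor K + 2 in the noise and in the error.\<close>

definition joined :: "topology \<Rightarrow> nat set \<Rightarrow> nat \<Rightarrow> bool" where
  "joined G F e \<longleftrightarrow> (end1 G e, end2 G e) \<in> (adj G F)\<^sup>*"

text \<open>The number of components is the potential of the whole proof: it drops with every
  accepted edge, so it bounds the number of draws, and it yields the size of a spanning
  tree.\<close>

definition components :: "topology \<Rightarrow> nat set \<Rightarrow> nat set set" where
  "components G F = (\<lambda>u. (adj G F)\<^sup>* `` {u}) ` verts G"

lemma sym_adj: "sym (adj G F)"
  by (auto simp: sym_def adj_def insert_commute)

lemma adj_rtrancl_sym: "(u, v) \<in> (adj G F)\<^sup>* \<Longrightarrow> (v, u) \<in> (adj G F)\<^sup>*"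
  using sym_rtrancl[OF sym_adj] by (meson symD)

lemma adj_mono: "F \<subseteq> F' \<Longrightarrow> adj G F \<subseteq> adj G F'"
  by (auto simp: adj_def)

lemma adj_rtrancl_mono: "F \<subseteq> F' \<Longrightarrow> (u, v) \<in> (adj G F)\<^sup>* \<Longrightarrow> (u, v) \<in> (adj G F')\<^sup>*"
  using rtrancl_mono[OF adj_mono] by blast

lemma joined_mono: "F \<subseteq> F' \<Longrightarrow> joined G F e \<Longrightarrow> joined G F' e"
  unfolding joined_def by (rule adj_rtrancl_mono)

lemma end_adj: "e \<in> F \<Longrightarrow> (end1 G e, end2 G e) \<in> adj G F"
  by (auto simp: adj_def ends_def)

lemma adjE:
  assumes "(x, y) \<in> adj G F"
  obtains e where "e \<in> F" "x = end1 G e" "y = end2 G e" | e where "e \<in> F" "x = end2 G e" "y = end1 G e"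
  using assms by (auto simp: adj_def ends_def doubleton_eq_iff)

text \<open>Each edge of a path is bypassed separately. This serves to delete or exchange an edge of
  a tree without following whole paths.\<close>

lemma adj_rtrancl_subset:
  assumes "\<And>e. e \<in> F \<Longrightarrow> joined G F' e" "(x, y) \<in> (adj G F)\<^sup>*"
  shows "(x, y) \<in> (adj G F')\<^sup>*"
  using assms(2)
proof (induction rule: rtrancl_induct)
  case (step y z)
  from step(2) have "(y, z) \<in> (adj G F')\<^sup>*"
    by (rule adjE) (use assms(1) adj_rtrancl_sym in \<open>auto simp: joined_def\<close>)
  with step(3) show ?case by (rule rtrancl_trans)
qed auto

lemma joined_if_mem: "e \<in> F \<Longrightarrow> joined G F e"
  unfolding joined_def by (rule r_into_rtrancl[OF end_adj])

text \<open>Repeated use of \<open>e\<close> on a path need not be recorded: after one crossing, a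
  second one ends at a vertex that \<open>F\<close> alone reaches.\<close>

lemma adj_rtrancl_insertD:
  assumes "(x, y) \<in> (adj G (insert e F))\<^sup>*"
  shows "(x, y) \<in> (adj G F)\<^sup>* \<or>
    ((x, end1 G e) \<in> (adj G F)\<^sup>* \<and> (end2 G e, y) \<in> (adj G F)\<^sup>*) \<or>
    ((x, end2 G e) \<in> (adj G F)\<^sup>* \<and> (end1 G e, y) \<in> (adj G F)\<^sup>*)"
  using assms
proof (induction rule: rtrancl_induct)
  case base
  then show ?case by auto
next
  case (step y z)
  show ?case
  proof (cases "(y, z) \<in> adj G F")
    case True
    then show ?thesis using step.IH by (meson rtrancl.rtrancl_into_rtrancl)
  next
    case False
    then have "(y = end1 G e \<and> z = end2 G e) \<or> (y = end2 G e \<and> z = end1 G e)"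
      using step(2) by (auto simp: adj_def ends_def doubleton_eq_iff)
    then show ?thesis using step.IH
      by (metis adj_rtrancl_sym rtrancl.rtrancl_refl rtrancl_trans)
  qed
qed

lemma component_eq_iff:
  "(adj G F)\<^sup>* `` {u} = (adj G F)\<^sup>* `` {v} \<longleftrightarrow> (u, v) \<in> (adj G F)\<^sup>*"
proof
  assume "(u, v) \<in> (adj G F)\<^sup>*"
  then show "(adj G F)\<^sup>* `` {u} = (adj G F)\<^sup>* `` {v}"
    using adj_rtrancl_sym[of u v G F] by (auto intro: rtrancl_trans)
qed (auto dest: equalityD2)

lemma finite_components: "finite (components G F)"
  by (simp add: components_def verts_def)

lemma finite_edges: "finite (edges G)"
  by (simp add: edges_def)

text \<open>Closing a class under the new adjacency maps the old classes onto the new ones. An edge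
  between different classes identifies two of them, so the map is not injective.\<close>

lemma card_components_insert:
  assumes "F \<subseteq> edges G" "e \<in> edges G" "simple_graph G" "\<not> joined G F e"
  shows "card (components G (insert e F)) < card (components G F)"
proof -
  let ?C = "\<lambda>F u. (adj G F)\<^sup>* `` {u}"
  define f where "f c = (adj G (insert e F))\<^sup>* `` c" for c
  have f: "f (?C F u) = ?C (insert e F) u" for u
    unfolding f_def
    using adj_rtrancl_mono[of F "insert e F"] by (auto intro: rtrancl_trans)
  have im: "f ` components G F = components G (insert e F)"
    unfolding components_def image_image f ..
  have v: "end1 G e \<in> verts G" "end2 G e \<in> verts G"
    using assms(2,3) by (auto simp: simple_graph_def ends_def)
  have "\<not> inj_on f (components G F)"
  proof
    assume inj: "inj_on f (components G F)"
    have "f (?C F (end1 G e)) = f (?C F (end2 G e))"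
      unfolding f component_eq_iff using joined_if_mem[of e "insert e F"] by (simp add: joined_def)
    with inj v have "?C F (end1 G e) = ?C F (end2 G e)"
      by (auto simp: inj_on_def components_def)
    with assms(4) show False by (simp add: component_eq_iff joined_def)
  qed
  then show ?thesis
    using im finite_components[of G F] card_image_le[of "components G F" f] eq_card_imp_inj_on[of "components G F" f]
    by (metis le_neq_implies_less)
qed

text \<open>The same map becomes injective once the class of one end of \<open>e\<close> is left
  out, because every new connection passes through that end.\<close>

lemma card_components_insert_ge:
  "card (components G F) \<le> Suc (card (components G (insert e F)))"
proof -
  let ?C = "\<lambda>F u. (adj G F)\<^sup>* `` {u}"
  define f where "f c = (adj G (insert e F))\<^sup>* `` c" for c
  have f: "f (?C F u) = ?C (insert e F) u" for u
    unfolding f_def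
    using adj_rtrancl_mono[of F "insert e F"] by (auto intro: rtrancl_trans)
  have im: "f ` components G F = components G (insert e F)"
    unfolding components_def image_image f ..
  let ?c = "?C F (end1 G e)"
  have "inj_on f (components G F - {?c})"
  proof (rule inj_onI)
    fix a b assume *: "a \<in> components G F - {?c}" "b \<in> components G F - {?c}" "f a = f b"
    then obtain x y where xy: "a = ?C F x" "b = ?C F y" by (auto simp: components_def)
    with * have "(x, y) \<in> (adj G (insert e F))\<^sup>*" by (simp add: f component_eq_iff)
    moreover have "(x, end1 G e) \<notin> (adj G F)\<^sup>*" "(end1 G e, y) \<notin> (adj G F)\<^sup>*"
      using * xy component_eq_iff[of G F] by auto
    ultimately have "(x, y) \<in> (adj G F)\<^sup>*"
      using adj_rtrancl_insertD by blast
    then show "a = b" using xy by (simp add: component_eq_iff)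
  qed
  then have "card (components G F - {?c}) \<le> card (components G (insert e F))"
    using im finite_components[of G "insert e F"] by (intro card_inj_on_le[of f]) auto
  then show ?thesis
    using card_Diff1_le[of "components G F" ?c] finite_components[of G F]
    by (metis card_Suc_Diff1 card_Diff_singleton_if Suc_le_mono diff_le_self diff_Suc_1 le_SucI)
qed

lemma card_components_empty: "card (components G {}) = nverts G"
proof -
  have "adj G {} = {}" by (auto simp: adj_def)
  then have "components G {} = (\<lambda>u. {u}) ` verts G"
    by (auto simp: components_def)
  then show ?thesis by (simp add: card_image verts_def)
qed

lemma nverts_le_card_components:
  "finite F \<Longrightarrow> nverts G \<le> card (components G F) + card F"
proof (induction F rule: finite_induct)
  case (insert e F)
  then show ?case using card_components_insert_ge[of G F e] by simp
qed (simp add: card_components_empty)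

lemma card_components_connected:
  assumes "connects G F" "1 \<le> nverts G"
  shows "card (components G F) = 1"
proof -
  have "1 \<in> verts G" using assms by (auto simp: verts_def)
  then have "components G F = {(adj G F)\<^sup>* `` {1}}"
    using assms(1) unfolding components_def connects_def
    by (auto simp: image_iff component_eq_iff)
       (metis Image_singleton_iff component_eq_iff)+
  then show ?thesis by simp
qed

section \<open>Cycles, redundant edges and spanning trees\<close>

definition irredundant :: "topology \<Rightarrow> nat set \<Rightarrow> bool" where
  "irredundant G F \<longleftrightarrow> (\<forall>e\<in>F. \<not> joined G (F - {e}) e)"

lemma irredundant_card_components:
  assumes "F \<subseteq> edges G" "simple_graph G" "irredundant G F"
  shows "card (components G F) + card F \<le> nverts G"
proof -
  have "finite F" using assms(1) finite_edges finite_subset by blast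
  then show ?thesis using assms
  proof (induction F rule: finite_induct)
    case (insert e F)
    have "irredundant G F"
      using insert.prems(3) joined_mono[of "F - {_}" "insert e F - {_}" G]
      unfolding irredundant_def by (metis Diff_mono insertI2 order_refl subset_insertI)
    moreover have "\<not> joined G F e" using insert unfolding irredundant_def by auto
    ultimately show ?case
      using insert card_components_insert[of F G e] by simp
  qed (simp add: card_components_empty)
qed

text \<open>The edge between the first two vertices is bypassed by walking around the rest of the
  cycle. With \<open>redundant_cycle\<close> this translates acyclicity into
  \<open>irredundant\<close>, which suits induction on edge sets.\<close>

lemma cycle_redundant:
  assumes "is_cycle G T vs"
  shows "\<exists>e\<in>T. joined G (T - {e}) e"
proof -
  let ?k = "length vs"
  have k: "3 \<le> ?k" and d: "distinct vs"
    and a: "\<And>i. i < ?k \<Longrightarrow> (vs ! i, vs ! (Suc i mod ?k)) \<in> adj G T"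
    using assms by (auto simp: is_cycle_def)
  have "0 < ?k" "Suc 0 mod ?k = 1" using k by auto
  with a[OF \<open>0 < ?k\<close>] have "(vs ! 0, vs ! 1) \<in> adj G T" by simp
  then obtain e where e: "e \<in> T" "ends G e = {vs ! 0, vs ! 1}"
    by (auto simp: adj_def)
  \<comment> \<open>Another side equal to the first one would be that side traversed backwards, with
    \<open>i = 1\<close> and successor 0; this happens only in a cycle of length 2.\<close>
  have st: "(vs ! i, vs ! (Suc i mod ?k)) \<in> adj G (T - {e})" if i: "i \<ge> 1" "i < ?k" for i
  proof -
    from a[OF i(2)] obtain f where f: "f \<in> T" "ends G f = {vs ! i, vs ! (Suc i mod ?k)}"
      by (auto simp: adj_def)
    have "f \<noteq> e"
    proof
      assume "f = e"
      with e f have "{vs ! i, vs ! (Suc i mod ?k)} = {vs ! 0, vs ! 1}" by simp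
      moreover have "vs ! i \<noteq> vs ! 0" using d i k by (subst nth_eq_iff_index_eq) auto
      ultimately have "vs ! i = vs ! 1" "vs ! (Suc i mod ?k) = vs ! 0"
        by (auto simp: doubleton_eq_iff)
      moreover have "1 < ?k" "0 < ?k" using k by linarith+
      moreover from this have "Suc i mod ?k < ?k" by (intro mod_less_divisor)
      ultimately have "i = 1" "Suc i mod ?k = 0"
        using nth_eq_iff_index_eq[OF d] i(2) by blast+
      then show False using k by auto
    qed
    with f show ?thesis by (auto simp: adj_def)
  qed
  have p: "(vs ! 1, vs ! i) \<in> (adj G (T - {e}))\<^sup>*" if "i \<ge> 1" "i < ?k" for i
    using that
  proof (induction i rule: dec_induct)
    case (step i)
    then show ?case using st[of i] by (auto intro: rtrancl_into_rtrancl)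
  qed auto
  have "(vs ! 1, vs ! (?k - 1)) \<in> (adj G (T - {e}))\<^sup>*" using p k by auto
  moreover have "(vs ! (?k - 1), vs ! 0) \<in> adj G (T - {e})"
  proof -
    have "1 \<le> ?k - 1" "?k - 1 < ?k" "Suc (?k - 1) = ?k" using k by linarith+
    with st[of "?k - 1"] show ?thesis by simp
  qed
  ultimately have "(vs ! 1, vs ! 0) \<in> (adj G (T - {e}))\<^sup>*" by auto
  then have "joined G (T - {e}) e"
    using e adj_rtrancl_sym unfolding joined_def ends_def by (auto simp: doubleton_eq_iff)
  with e(1) show ?thesis by blast
qed

lemma rtrancl_distinct_path:
  assumes "(x, y) \<in> r\<^sup>*"
  shows "\<exists>vs. vs \<noteq> [] \<and> hd vs = x \<and> last vs = y \<and> distinct vs \<and>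
    (\<forall>i. Suc i < length vs \<longrightarrow> (vs ! i, vs ! Suc i) \<in> r)"
  using assms
proof (induction rule: converse_rtrancl_induct)
  case base
  then show ?case by (intro exI[of _ "[y]"]) auto
next
  case (step x z)
  then obtain vs where vs: "vs \<noteq> []" "hd vs = z" "last vs = y" "distinct vs"
    "\<And>i. Suc i < length vs \<Longrightarrow> (vs ! i, vs ! Suc i) \<in> r" by blast
  show ?case
  proof (cases "x \<in> set vs")
    case True
    then obtain j where j: "j < length vs" "vs ! j = x" by (auto simp: in_set_conv_nth)
    then show ?thesis
      using vs by (intro exI[of _ "drop j vs"]) (auto simp: hd_drop_conv_nth)
  next
    case False
    have "((x # vs) ! i, (x # vs) ! Suc i) \<in> r" if "Suc i < length (x # vs)" for i
      using that vs step(1) by (cases i) (auto simp: hd_conv_nth)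
    then show ?thesis using vs False by (intro exI[of _ "x # vs"]) auto
  qed
qed

text \<open>A path without repetitions between the ends of \<open>e\<close> is closed by
  \<open>e\<close>. Simplicity excludes the short cases: one vertex would mean a loop, two vertices
  a parallel edge.\<close>

lemma redundant_cycle:
  assumes "simple_graph G" "T \<subseteq> edges G" "e \<in> T" "joined G (T - {e}) e"
  shows "\<exists>vs. is_cycle G T vs"
proof -
  let ?u = "end1 G e" and ?v = "end2 G e"
  have uv: "?u \<noteq> ?v" using assms by (auto simp: simple_graph_def)
  obtain vs where vs: "vs \<noteq> []" "hd vs = ?u" "last vs = ?v" "distinct vs"
    "\<And>i. Suc i < length vs \<Longrightarrow> (vs ! i, vs ! Suc i) \<in> adj G (T - {e})"
    using rtrancl_distinct_path[OF assms(4)[unfolded joined_def]] by blast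
  have l1: "length vs \<noteq> 1" using vs uv by (auto simp: length_Suc_conv)
  have l2: "length vs \<noteq> 2"
  proof
    assume "length vs = 2"
    then have "vs = [?u, ?v]" using vs by (auto simp: length_Suc_conv numeral_2_eq_2)
    with vs(5)[of 0] have "(?u, ?v) \<in> adj G (T - {e})" by auto
    then obtain f where f: "f \<in> T" "f \<noteq> e" "ends G f = ends G e" by (auto simp: adj_def ends_def)
    then show False using assms by (auto simp: simple_graph_def dest: inj_onD)
  qed
  have "length vs \<noteq> 0" using vs by simp
  then have l: "3 \<le> length vs" using l1 l2 by linarith
  have "(vs ! i, vs ! (Suc i mod length vs)) \<in> adj G T" if i: "i < length vs" for i
  proof (cases "Suc i < length vs")
    case True
    then show ?thesis using vs(5)[of i] adj_mono[of "T - {e}" T G] by auto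
  next
    case False
    then have "Suc i = length vs" using i by simp
    then have "vs ! i = ?v" "vs ! (Suc i mod length vs) = ?u"
      using vs by (auto simp: last_conv_nth hd_conv_nth simp flip: \<open>Suc i = length vs\<close>)
    then show ?thesis using end_adj[OF assms(3)] sym_adj by (auto dest: symD)
  qed
  then show ?thesis using l vs by (auto simp: is_cycle_def)
qed

lemma spanning_tree_irredundant:
  "simple_graph G \<Longrightarrow> spanning_tree G T \<Longrightarrow> irredundant G T"
  using redundant_cycle unfolding spanning_tree_def irredundant_def by meson

lemma card_spanning_tree:
  assumes "connected_graph G" "spanning_tree G T"
  shows "Suc (card T) = nverts G"
proof -
  have T: "T \<subseteq> edges G" "connects G T" using assms by (auto simp: spanning_tree_def)
  have G: "1 \<le> nverts G" "simple_graph G" using assms by (auto simp: connected_graph_def)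
  have "finite T" using T finite_edges finite_subset by blast
  then show ?thesis
    using nverts_le_card_components[of T G] card_components_connected[OF T(2) G(1)]
      irredundant_card_components[OF T(1) G(2) spanning_tree_irredundant[OF G(2) assms(2)]] by linarith
qed

text \<open>Counting replaces a check of acyclicity: an edge on a cycle could be dropped, which
  would leave too few edges to connect n vertices.\<close>

lemma spanning_treeI:
  assumes "connected_graph G" "T \<subseteq> edges G" "connects G T" "Suc (card T) \<le> nverts G"
  shows "spanning_tree G T"
proof -
  have "\<not> is_cycle G T vs" for vs
  proof
    assume "is_cycle G T vs"
    then obtain e where e: "e \<in> T" "joined G (T - {e}) e" using cycle_redundant by blast
    have fin: "finite T" using assms finite_edges finite_subset by blast
    have j: "joined G (T - {e}) f" if "f \<in> T" for f
      using that e by (cases "f = e") (auto intro: joined_if_mem)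
    have "connects G (T - {e})"
      using assms(3) adj_rtrancl_subset[OF j] by (auto simp: connects_def)
    then have "card (components G (T - {e})) = 1"
      using assms by (intro card_components_connected) (auto simp: connected_graph_def)
    moreover have "0 < card T" using fin e by (auto simp: card_gt_0_iff)
    ultimately show False
      using nverts_le_card_components[of "T - {e}" G] fin e assms(4) by simp
  qed
  then show ?thesis using assms by (auto simp: spanning_tree_def)
qed

text \<open>A minimal subset \<open>P\<close> of \<open>T\<close> that joins the ends of
  \<open>e\<close> plays the role of the tree path between them. It leaves \<open>S\<close> at some
  \<open>f\<close>, and by minimality \<open>f\<close> is indispensable in \<open>P\<close>, so
  \<open>e\<close> and the rest of \<open>P\<close> bypass \<open>f\<close>. In the application
  \<open>S\<close> holds the lighter edges, which makes \<open>f\<close> heavier than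
  \<open>e\<close>.\<close>

lemma spanning_tree_exchange:
  assumes G: "connected_graph G" and T: "spanning_tree G T"
    and e: "e \<in> edges G" "e \<notin> T" and S: "\<not> joined G (T \<inter> S) e"
  obtains f where "f \<in> T - S" "spanning_tree G (insert e (T - {f}))"
proof -
  have TE: "T \<subseteq> edges G" "connects G T" using T by (auto simp: spanning_tree_def)
  have fin: "finite T" using TE finite_edges finite_subset by blast
  have "joined G T e"
    using TE e G by (auto simp: joined_def connects_def connected_graph_def simple_graph_def ends_def)
  define Q where "Q = {P. P \<subseteq> T \<and> joined G P e}"
  have "finite Q" "T \<in> Q" using fin \<open>joined G T e\<close> by (auto simp: Q_def)
  then obtain P where P: "P \<in> Q" "\<And>P'. P' \<in> Q \<Longrightarrow> P' \<subseteq> P \<Longrightarrow> P' = P"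
    using finite_has_minimal2[of Q T] by (metis)
  have "\<not> P \<subseteq> S"
  proof
    assume "P \<subseteq> S"
    then have "P \<subseteq> T \<inter> S" using P by (auto simp: Q_def)
    then show False using P(1) S joined_mono[of P "T \<inter> S"] by (auto simp: Q_def)
  qed
  then obtain f where f: "f \<in> P" "f \<notin> S" by blast
  have PT: "P \<subseteq> T" "joined G P e" using P by (auto simp: Q_def)
  have nj: "\<not> joined G (P - {f}) e" using P(2)[of "P - {f}"] PT f by (auto simp: Q_def)
  have "(end1 G e, end2 G e) \<in> (adj G (insert f (P - {f})))\<^sup>*"
    using PT f by (simp add: joined_def insert_absorb)
  then have or: "((end1 G e, end1 G f) \<in> (adj G (P - {f}))\<^sup>* \<and> (end2 G f, end2 G e) \<in> (adj G (P - {f}))\<^sup>*) \<or>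
    ((end1 G e, end2 G f) \<in> (adj G (P - {f}))\<^sup>* \<and> (end1 G f, end2 G e) \<in> (adj G (P - {f}))\<^sup>*)"
    using adj_rtrancl_insertD nj unfolding joined_def by blast
  let ?T = "insert e (T - {f})"
  have sub: "P - {f} \<subseteq> ?T" using PT by auto
  have m: "(x, y) \<in> (adj G (P - {f}))\<^sup>* \<Longrightarrow> (x, y) \<in> (adj G ?T)\<^sup>*" for x y
    by (rule adj_rtrancl_mono[OF sub])
  have je: "(end1 G e, end2 G e) \<in> (adj G ?T)\<^sup>*" using joined_if_mem[of e ?T] by (simp add: joined_def)
  have jf: "joined G ?T f"
    unfolding joined_def using or m je adj_rtrancl_sym by (meson rtrancl_trans)
  have j: "joined G ?T g" if "g \<in> T" for g
    using that jf by (cases "g = f") (auto intro: joined_if_mem)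
  have "connects G ?T" using TE(2) adj_rtrancl_subset[OF j] by (auto simp: connects_def)
  moreover have "card ?T = card T" using e f PT fin by (auto simp: card_insert_if card_Diff_singleton_if)
     (metis Suc_pred card_gt_0_iff empty_iff subsetD)
  ultimately have "spanning_tree G ?T"
    using TE e card_spanning_tree[OF G T] by (intro spanning_treeI[OF G]) auto
  then show thesis using f PT that by blast
qed

section \<open>Kruskal's algorithm on a strictly ordered edge list\<close>

fun kruskal :: "topology \<Rightarrow> nat set \<Rightarrow> nat list \<Rightarrow> nat set" where
  "kruskal G F [] = F"
| "kruskal G F (e # es) = kruskal G (if joined G F e then F else insert e F) es"

text \<open>The accumulator always equals \<open>T\<close> restricted to the edges read so far: an
  edge of \<open>T\<close> is accepted because \<open>T\<close> is irredundant, and another edge is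
  rejected because accepting it would permit an exchange for a heavier edge. The strict order thus
  leaves only one minimum spanning tree.\<close>

lemma mst_eq_kruskal_aux:
  assumes G: "connected_graph G" and T: "minimum_spanning_tree G w T"
    and "xs @ ys = zs" "set zs = edges G" "sorted_wrt (\<lambda>e f. w e < w f) zs"
  shows "kruskal G (T \<inter> set xs) ys = T"
  using assms(3-)
proof (induction ys arbitrary: xs)
  case Nil
  then show ?case using T by (auto simp: minimum_spanning_tree_def spanning_tree_def)
next
  case (Cons e ys)
  have st: "spanning_tree G T" using T by (simp add: minimum_spanning_tree_def)
  then have TE: "T \<subseteq> edges G" by (auto simp: spanning_tree_def)
  have fin: "finite T" using TE finite_edges finite_subset by blast
  have "e \<in> set zs" unfolding Cons.prems(1)[symmetric] by simp
  then have e: "e \<in> edges G" unfolding Cons.prems(2) .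
  have sd: "\<forall>x\<in>set xs. w x < w e" "\<forall>y\<in>set ys. w e < w y"
    using Cons.prems(3) unfolding Cons.prems(1)[symmetric] by (auto simp: sorted_wrt_append)
  have "T \<inter> set (xs @ [e]) = (if joined G (T \<inter> set xs) e then T \<inter> set xs else insert e (T \<inter> set xs))"
  proof (cases "e \<in> T")
    case True
    have "\<not> joined G (T - {e}) e"
      using spanning_tree_irredundant[OF _ st] G True by (auto simp: irredundant_def connected_graph_def)
    moreover have "e \<notin> set xs" using sd by auto
    ultimately have "\<not> joined G (T \<inter> set xs) e"
      using joined_mono[of "T \<inter> set xs" "T - {e}" G e] by blast
    then show ?thesis using True by auto
  next
    case False
    have "joined G (T \<inter> set xs) e"
    proof (rule ccontr)
      assume "\<not> joined G (T \<inter> set xs) e"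
      then obtain f where f: "f \<in> T - set xs" "spanning_tree G (insert e (T - {f}))"
        using spanning_tree_exchange[OF G st e False] by blast
      then have "f \<in> set zs" "f \<notin> set xs" "f \<noteq> e" using TE Cons.prems(2) False by blast+
      then have "w e < w f" unfolding Cons.prems(1)[symmetric] using sd(2) by auto
      moreover have "weight w (insert e (T - {f})) = weight w T - w f + w e"
        using f fin False by (auto simp: weight_def sum_diff1)
      moreover have "weight w T \<le> weight w (insert e (T - {f}))"
        using T f by (auto simp: minimum_spanning_tree_def)
      ultimately show False by linarith
    qed
    then show ?thesis using False by auto
  qed
  then show ?case using Cons.IH[of "xs @ [e]"] Cons.prems by simp
qed

lemma mst_eq_kruskal:
  assumes "connected_graph G" "minimum_spanning_tree G w T"
    "set zs = edges G" "sorted_wrt (\<lambda>e f. w e < w f) zs"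
  shows "T = kruskal G {} zs"
  using mst_eq_kruskal_aux[OF assms(1,2), of "[]" zs zs] assms(3,4) by simp

text \<open>Turns the ln m of the error analysis into 2 ln n.\<close>

lemma nedges_le:
  assumes "simple_graph G"
  shows "nedges G \<le> nverts G ^ 2"
proof -
  have "inj_on (\<lambda>e. (end1 G e, end2 G e)) (edges G)"
    using assms by (auto simp: simple_graph_def inj_on_def ends_def)
  moreover have "(\<lambda>e. (end1 G e, end2 G e)) ` edges G \<subseteq> verts G \<times> verts G"
    using assms by (auto simp: simple_graph_def ends_def)
  ultimately have "card (edges G) \<le> card (verts G \<times> verts G)"
    by (intro card_inj_on_le) (auto simp: verts_def)
  then show ?thesis by (simp add: edges_def verts_def card_cartesian_product power2_eq_square)
qed

section \<open>Greedy selection along a Plackett--Luce random order\<close>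

text \<open>Meant for distinct lists: there the denominator is the total rate of the entries not
  drawn yet.\<close>

fun plackett_luce :: "('a \<Rightarrow> real) \<Rightarrow> 'a list \<Rightarrow> real" where
  "plackett_luce l [] = 1"
| "plackett_luce l (e # es) = l e / (l e + sum l (set es)) * plackett_luce l es"

lemma plackett_luce_nonneg: "(\<And>e. e \<in> set p \<Longrightarrow> 0 < l e) \<Longrightarrow> 0 \<le> plackett_luce l p"
proof (induction p)
  case (Cons e p)
  have "0 \<le> sum l (set p)" using Cons.prems by (intro sum_nonneg) (auto intro: less_imp_le)
  moreover have "0 < l e" "0 \<le> plackett_luce l p" using Cons by auto
  ultimately show ?case by simp
qed simp

text \<open>An expectation covers both events, with an indicator for \<open>h\<close>, and the total
  mass, with \<open>h\<close> constant 1. A general start \<open>F\<close> is what the recursion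
  over the choices calls for.\<close>

definition kruskal_mean ::
    "topology \<Rightarrow> (nat set \<Rightarrow> real) \<Rightarrow> (nat \<Rightarrow> real) \<Rightarrow> nat set \<Rightarrow> nat set \<Rightarrow> real" where
  "kruskal_mean G h l F R = (\<Sum>p\<in>permutations_of_set R. plackett_luce l p * h (kruskal G F p))"

lemma kruskal_mean_empty: "kruskal_mean G h l F {} = h F"
  by (simp add: kruskal_mean_def)

text \<open>Condition on the head of the order; the tail is again Plackett--Luce distributed on the
  remaining edges.\<close>

lemma kruskal_mean_rec:
  assumes "finite R" "R \<noteq> {}"
  shows "kruskal_mean G h l F R =
    (\<Sum>e\<in>R. l e / sum l R * kruskal_mean G h l (if joined G F e then F else insert e F) (R - {e}))"
proof -
  have "kruskal_mean G h l F R =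
      (\<Sum>p\<in>(\<Union>e\<in>R. (#) e ` permutations_of_set (R - {e})). plackett_luce l p * h (kruskal G F p))"
    unfolding kruskal_mean_def using permutations_of_set_nonempty[OF assms(2)] by simp
  also have "\<dots> = (\<Sum>e\<in>R. \<Sum>p\<in>(#) e ` permutations_of_set (R - {e}). plackett_luce l p * h (kruskal G F p))"
    using assms(1) by (intro sum.UNION_disjoint) auto
  also have "\<dots> = (\<Sum>e\<in>R. l e / sum l R * kruskal_mean G h l (if joined G F e then F else insert e F) (R - {e}))"
  proof (rule sum.cong)
    fix e assume e: "e \<in> R"
    have "(\<Sum>p\<in>(#) e ` permutations_of_set (R - {e}). plackett_luce l p * h (kruskal G F p)) =
        (\<Sum>p\<in>permutations_of_set (R - {e}). plackett_luce l (e # p) * h (kruskal G F (e # p)))"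
      by (subst sum.reindex) (auto simp: inj_on_def)
    also have "\<dots> = (\<Sum>p\<in>permutations_of_set (R - {e}). l e / sum l R * (plackett_luce l p *
        h (kruskal G (if joined G F e then F else insert e F) p)))"
      using assms(1) e by (intro sum.cong) (auto simp: permutations_of_setD(1) sum.remove)
    finally show "(\<Sum>p\<in>(#) e ` permutations_of_set (R - {e}). plackett_luce l p * h (kruskal G F p)) =
        l e / sum l R * kruskal_mean G h l (if joined G F e then F else insert e F) (R - {e})"
      by (simp add: kruskal_mean_def sum_distrib_left)
  qed auto
  finally show ?thesis .
qed

text \<open>The recursion above is reused for the constant function 1, with an arbitrary
  graph.\<close>

lemma sum_plackett_luce:
  fixes l :: "nat \<Rightarrow> real"
  assumes "finite R" "\<And>e. e \<in> R \<Longrightarrow> 0 < l e"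
  shows "(\<Sum>p\<in>permutations_of_set R. plackett_luce l p) = 1"
proof -
  have "kruskal_mean G (\<lambda>_. 1) l F R = 1" for G F
    using assms
  proof (induction R arbitrary: F rule: finite_psubset_induct)
    case (psubset R)
    show ?case
    proof (cases "R = {}")
      case False
      have "kruskal_mean G (\<lambda>_. 1) l F R = (\<Sum>e\<in>R. l e / sum l R)"
        unfolding kruskal_mean_rec[OF psubset(1) False]
      proof (rule sum.cong)
        fix e assume "e \<in> R"
        then have "kruskal_mean G (\<lambda>_. 1) l F' (R - {e}) = 1" for F'
          using psubset(3) by (intro psubset(2)) auto
        then show "l e / sum l R * kruskal_mean G (\<lambda>_. 1) l (if joined G F e then F else insert e F) (R - {e}) =
          l e / sum l R" by simp
      qed simp
      also have "\<dots> = 1"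
        using sum_pos[OF psubset(1) False, of l] psubset(3) by (simp flip: sum_divide_distrib)
      finally show ?thesis .
    qed (simp add: kruskal_mean_empty)
  qed
  then show ?thesis by (simp add: kruskal_mean_def)
qed

definition active :: "topology \<Rightarrow> nat set \<Rightarrow> nat set \<Rightarrow> nat set" where
  "active G F R = {e\<in>R. \<not> joined G F e}"

text \<open>Discarding the edges that can no longer be chosen turns the random order of all edges into a
  sequence of fewer than \<open>n\<close> choices, each of them an exponential mechanism.\<close>

lemma kruskal_mean_active:
  assumes "finite R" "\<And>e. e \<in> R \<Longrightarrow> 0 < l e"
  shows "kruskal_mean G h l F R = kruskal_mean G h l F (active G F R)"
  using assms
proof (induction R arbitrary: F rule: finite_psubset_induct)
  case (psubset R)
  let ?W = "kruskal_mean G h l" and ?A = "active G F R"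
  have A: "?A \<subseteq> R" "finite ?A" using psubset(1) by (auto simp: active_def)
  show ?case
  proof (cases "R = {}")
    case False
    have L: "0 < sum l R" using sum_pos[OF psubset(1) False, of l] psubset(3) by auto
    \<comment> \<open>A rejected edge changes neither the forest nor the active set, so the value is
      that of \<open>?A\<close> already.\<close>
    have 1: "?W F (R - {e}) = ?W F ?A" if "e \<in> R - ?A" for e
    proof -
      have "active G F (R - {e}) = ?A" using that by (auto simp: active_def)
      then show ?thesis using psubset(2)[of "R - {e}" F] psubset(3) that by auto
    qed
    \<comment> \<open>Accepting \<open>e\<close> may deactivate further edges, but
      \<open>R - {e}\<close> and \<open>?A - {e}\<close> keep the same active part
      afterwards.\<close>
    have 2: "?W (insert e F) (R - {e}) = ?W (insert e F) (?A - {e})" if "e \<in> ?A" for e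
    proof -
      have "active G (insert e F) (R - {e}) = active G (insert e F) (?A - {e})"
        using joined_mono[of F "insert e F" G] by (auto simp: active_def)
      moreover have "?W (insert e F) (R - {e}) = ?W (insert e F) (active G (insert e F) (R - {e}))"
        using that A psubset(3) by (intro psubset(2)) auto
      moreover have "?W (insert e F) (?A - {e}) = ?W (insert e F) (active G (insert e F) (?A - {e}))"
        using that A psubset(3) by (intro psubset(2)) auto
      ultimately show ?thesis by simp
    qed
    have 3: "(\<Sum>e\<in>?A. l e * ?W (insert e F) (?A - {e})) = sum l ?A * ?W F ?A"
    proof (cases "?A = {}")
      case False
      have "0 < sum l ?A" using sum_pos[OF A(2) False, of l] psubset(3) A(1) by auto
      moreover have "?W F ?A = (\<Sum>e\<in>?A. l e / sum l ?A * ?W (insert e F) (?A - {e}))"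
        unfolding kruskal_mean_rec[OF A(2) False, of G h l F]
        by (intro sum.cong) (auto simp: active_def)
      ultimately show ?thesis
        by (simp add: sum_distrib_left field_simps)
    qed simp
    \<comment> \<open>Each rejected edge contributes its rate times the value at \<open>?A\<close>,
      and the accepted ones reproduce the recursion at \<open>?A\<close>; the rates add up to
      \<open>sum l R\<close> again.\<close>
    have "sum l R * ?W F R = (\<Sum>e\<in>R. l e * ?W (if joined G F e then F else insert e F) (R - {e}))"
      unfolding kruskal_mean_rec[OF psubset(1) False, of G h l F] sum_distrib_left using L by simp
    also have "\<dots> = (\<Sum>e\<in>R - ?A. l e * ?W (if joined G F e then F else insert e F) (R - {e})) +
        (\<Sum>e\<in>?A. l e * ?W (if joined G F e then F else insert e F) (R - {e}))"
      using A psubset(1) by (intro sum.subset_diff)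
    also have "(\<Sum>e\<in>R - ?A. l e * ?W (if joined G F e then F else insert e F) (R - {e})) =
        (\<Sum>e\<in>R - ?A. l e * ?W F ?A)"
      using 1 by (intro sum.cong) (auto simp: active_def)
    also have "(\<Sum>e\<in>?A. l e * ?W (if joined G F e then F else insert e F) (R - {e})) =
        (\<Sum>e\<in>?A. l e * ?W (insert e F) (?A - {e}))"
      using 2 by (intro sum.cong) (auto simp: active_def)
    also note 3
    also have "(\<Sum>e\<in>R - ?A. l e * ?W F ?A) + sum l ?A * ?W F ?A = sum l R * ?W F ?A"
      using A psubset(1) by (simp add: sum.subset_diff[of ?A R l] distrib_right sum_distrib_right)
    finally show ?thesis using L by simp
  qed (simp add: active_def)
qed

section \<open>Renyi moments and their composition\<close>

lemma exp_le_add_exp_square: "exp (x::real) \<le> x + exp (x\<^sup>2)"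
proof (cases "x \<le> 1")
  case True
  \<comment> \<open>This polynomial separates the two sides up to 1; beyond 1 already x \<le> x^2
    suffices.\<close>
  have "exp x \<le> 1 + x + x\<^sup>2"
  proof (cases "0 \<le> x")
    case True
    then show ?thesis using exp_bound[of x] \<open>x \<le> 1\<close> by simp
  next
    case False
    define y where "y = - x"
    have y: "y > 0" using False y_def by simp
    have "1 + y \<le> exp y" by (rule exp_ge_add_one_self_aux) (use y in simp)
    then have "exp (- y) \<le> 1 / (1 + y)" using y by (simp add: exp_minus field_simps)
    also have "\<dots> \<le> 1 - y + y\<^sup>2" using y by (simp add: field_simps power2_eq_square)
    finally show ?thesis by (simp add: y_def)
  qed
  also have "\<dots> \<le> x + exp (x\<^sup>2)" using exp_ge_add_one_self[of "x\<^sup>2"] by simp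
  finally show ?thesis .
next
  case False
  then have "x \<le> x\<^sup>2" by (simp add: power2_eq_square)
  then have "exp x \<le> exp (x\<^sup>2)" by simp
  then show ?thesis using False by (simp add: add_increasing)
qed

text \<open>Bounds one step of the composition. As \<open>p\<close> and \<open>q\<close> are distributions, the mean of
  \<open>ln (p e / q e)\<close> under \<open>q\<close> is not positive, so that only the quadratic term of the moment
  generating function survives.\<close>

lemma renyi_moment_le:
  fixes p q :: "'a \<Rightarrow> real"
  assumes "\<And>e. e \<in> A \<Longrightarrow> 0 < p e" "\<And>e. e \<in> A \<Longrightarrow> 0 < q e" "sum p A = 1" "sum q A = 1"
    "\<And>e. e \<in> A \<Longrightarrow> \<bar>ln (p e / q e)\<bar> \<le> c" "0 \<le> \<alpha>"
  shows "(\<Sum>e\<in>A. p e powr \<alpha> * q e powr (1 - \<alpha>)) \<le> exp (\<alpha>\<^sup>2 * c\<^sup>2)"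
proof -
  have "(\<Sum>e\<in>A. p e powr \<alpha> * q e powr (1 - \<alpha>)) \<le> (\<Sum>e\<in>A. \<alpha> * (p e - q e) + q e * exp (\<alpha>\<^sup>2 * c\<^sup>2))"
  proof (rule sum_mono)
    fix e assume e: "e \<in> A"
    let ?r = "ln (p e / q e)"
    have pq: "0 < p e" "0 < q e" using assms e by auto
    have "p e powr \<alpha> * q e powr (1 - \<alpha>) = q e * exp (\<alpha> * ?r)"
      using pq by (simp add: powr_def ln_div algebra_simps exp_add exp_diff)
    \<comment> \<open>The quadratic part enters as an exponential without additive constant, so that
      summing against \<open>q\<close> leaves one factor, and such factors multiply under
      composition.\<close>
    also have "\<dots> \<le> q e * (\<alpha> * ?r + exp ((\<alpha> * ?r)\<^sup>2))"
      using pq exp_le_add_exp_square by (intro mult_left_mono) auto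
    also have "\<dots> \<le> q e * (\<alpha> * (p e / q e - 1) + exp (\<alpha>\<^sup>2 * c\<^sup>2))"
    proof (intro mult_left_mono add_mono)
      show "?r \<le> p e / q e - 1" using pq by (intro ln_le_minus_one) simp
      have "?r\<^sup>2 \<le> c\<^sup>2" using assms(5)[OF e] by (metis abs_ge_zero power2_abs power_mono)
      then show "exp ((\<alpha> * ?r)\<^sup>2) \<le> exp (\<alpha>\<^sup>2 * c\<^sup>2)" by (simp add: power_mult_distrib mult_left_mono)
    qed (use pq assms in auto)
    also have "\<dots> = \<alpha> * (p e - q e) + q e * exp (\<alpha>\<^sup>2 * c\<^sup>2)" using pq by (simp add: field_simps)
    finally show "p e powr \<alpha> * q e powr (1 - \<alpha>) \<le> \<alpha> * (p e - q e) + q e * exp (\<alpha>\<^sup>2 * c\<^sup>2)" .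
  qed
  also have "\<dots> = \<alpha> * (sum p A - sum q A) + sum q A * exp (\<alpha>\<^sup>2 * c\<^sup>2)"
    by (simp add: sum.distrib sum_distrib_left sum_distrib_right sum_subtractf right_diff_distrib)
  finally show ?thesis using assms by simp
qed

text \<open>The rate and the normalizing sum each change by a factor of at most exp \<eta>, so the
  log-ratio of the probabilities is at most 2 \<eta>; its square gives the 4.\<close>

lemma normalized_moment_le:
  fixes l l' :: "'a \<Rightarrow> real"
  assumes A: "finite A" "A \<noteq> {}"
    and l: "\<And>e. e \<in> A \<Longrightarrow> 0 < l e" "\<And>e. e \<in> A \<Longrightarrow> 0 < l' e"
    and c: "\<And>e. e \<in> A \<Longrightarrow> l e \<le> exp \<eta> * l' e" "\<And>e. e \<in> A \<Longrightarrow> l' e \<le> exp \<eta> * l e" and "0 \<le> \<alpha>"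
  shows "(\<Sum>e\<in>A. (l e / sum l A) powr \<alpha> * (l' e / sum l' A) powr (1 - \<alpha>)) \<le> exp (4 * \<alpha>\<^sup>2 * \<eta>\<^sup>2)"
proof -
  have L: "0 < sum l A" "0 < sum l' A" using A l by (auto intro!: sum_pos)
  have cL: "sum l A \<le> exp \<eta> * sum l' A" "sum l' A \<le> exp \<eta> * sum l A"
    using c by (auto simp: sum_distrib_left intro!: sum_mono)
  have le: "ln x - ln y \<le> \<eta>" if "0 < x" "0 < y" "x \<le> exp \<eta> * y" for x y :: real
    using ln_mono[OF that(3,1)] that by (simp add: ln_mult)
  have "(\<Sum>e\<in>A. (l e / sum l A) powr \<alpha> * (l' e / sum l' A) powr (1 - \<alpha>)) \<le> exp (\<alpha>\<^sup>2 * (2 * \<eta>)\<^sup>2)"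
  proof (rule renyi_moment_le)
    fix e assume e: "e \<in> A"
    show "\<bar>ln (l e / sum l A / (l' e / sum l' A))\<bar> \<le> 2 * \<eta>"
      using e L l[OF e] le[of "l e" "l' e"] le[of "l' e" "l e"] le[OF L cL(1)] le[OF L(2,1) cL(2)] c[OF e]
      by (simp add: ln_div ln_mult)
  qed (use L l assms in \<open>auto simp flip: sum_divide_distrib\<close>)
  then show ?thesis by (simp add: power_mult_distrib ac_simps)
qed

text \<open>The bound on \<open>a p - exp \<epsilon> b q\<close> by a Renyi moment is carried through the recursion with
  arbitrary \<open>a\<close> and \<open>b\<close>, which stand for the probabilities of the choices made so far.\<close>

lemma kruskal_mean_composition:
  assumes G: "simple_graph G"
    and l: "\<And>e. e \<in> edges G \<Longrightarrow> 0 < l e" "\<And>e. e \<in> edges G \<Longrightarrow> 0 < l' e"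
    and c: "\<And>e. e \<in> edges G \<Longrightarrow> l e \<le> exp \<eta> * l' e" "\<And>e. e \<in> edges G \<Longrightarrow> l' e \<le> exp \<eta> * l e"
    and h: "\<And>T. 0 \<le> h T" "\<And>T. h T \<le> 1" and \<alpha>: "1 \<le> \<alpha>"
    and "F \<subseteq> edges G" "R \<subseteq> edges G" "0 < a" "0 < b"
  shows "a * kruskal_mean G h l F R - exp \<epsilon> * b * kruskal_mean G h l' F R
    \<le> exp (- \<epsilon> * (\<alpha> - 1)) * (a powr \<alpha> * b powr (1 - \<alpha>)) * exp (4 * \<alpha>\<^sup>2 * \<eta>\<^sup>2) ^ card (components G F)"
  using assms(9-)
\<comment> \<open>Induction on the number of components and not on \<open>R\<close>: only accepted
  edges cost a factor.\<close>
proof (induction "card (components G F)" arbitrary: F R a b rule: less_induct)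
  case less
  let ?W = "kruskal_mean G h" and ?A = "active G F R" and ?B = "exp (4 * \<alpha>\<^sup>2 * \<eta>\<^sup>2)"
  let ?C = "exp (- \<epsilon> * (\<alpha> - 1))"
  have fin: "finite R" using less finite_edges finite_subset by blast
  have A: "?A \<subseteq> edges G" "finite ?A" using less fin by (auto simp: active_def)
  have act: "?W l F R = ?W l F ?A" "?W l' F R = ?W l' F ?A"
    using l less by (auto intro!: kruskal_mean_active fin)
  have B1: "1 \<le> ?B ^ k" for k by (simp add: one_le_power)
  show ?case
  proof (cases "?A = {}")
    case True
    have "(a - exp \<epsilon> * b) * h F \<le> ?C * (a powr \<alpha> * b powr (1 - \<alpha>))"
    proof (cases "a \<le> exp \<epsilon> * b")
      case True
      then have "(a - exp \<epsilon> * b) * h F \<le> 0" using h by (simp add: mult_nonpos_nonneg)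
      then show ?thesis by (rule order_trans) simp
    next
      case False
      have "(a - exp \<epsilon> * b) * h F \<le> (a - exp \<epsilon> * b) * 1"
        using False h by (intro mult_left_mono) auto
      also have "\<dots> \<le> a" using less by simp
      \<comment> \<open>Markov's inequality for the likelihood ratio: as 1 - \<alpha> is not
        positive, replacing \<open>a\<close> by the smaller \<open>exp \<epsilon> * b\<close> in the
        second factor increases the product.\<close>
      also have "\<dots> = a powr \<alpha> * a powr (1 - \<alpha>)" using less by (simp flip: powr_add)
      also have "\<dots> \<le> a powr \<alpha> * (exp \<epsilon> * b) powr (1 - \<alpha>)"
        using False \<alpha> less by (intro mult_left_mono powr_mono2') auto
      also have "(exp \<epsilon> * b) powr (1 - \<alpha>) = ?C * b powr (1 - \<alpha>)"
        using less.prems by (simp add: powr_def ln_mult algebra_simps flip: exp_add)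
      finally show ?thesis by (simp add: ac_simps)
    qed
    also have "\<dots> \<le> ?C * (a powr \<alpha> * b powr (1 - \<alpha>)) * ?B ^ card (components G F)"
      using B1 by (metis mult_le_cancel_left1 mult_nonneg_nonneg exp_ge_zero powr_ge_zero not_le)
    finally show ?thesis unfolding act True kruskal_mean_empty by (simp add: algebra_simps)
  next
    case False
    define p where "p e = l e / sum l ?A" for e
    define q where "q e = l' e / sum l' ?A" for e
    define k where "k = card (components G F) - 1"
    have L: "0 < sum l ?A" "0 < sum l' ?A" using A l False by (auto intro!: sum_pos)
    have pq: "0 < p e" "0 < q e" if "e \<in> ?A" for e using that A l L by (auto simp: p_def q_def)
    have lt: "card (components G (insert e F)) < card (components G F)" if "e \<in> ?A" for e
      using that less A G by (intro card_components_insert) (auto simp: active_def)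
    have k: "card (components G F) = Suc k" using lt False by (fastforce simp: k_def)
    have W: "?W l F ?A = (\<Sum>e\<in>?A. p e * ?W l (insert e F) (?A - {e}))"
            "?W l' F ?A = (\<Sum>e\<in>?A. q e * ?W l' (insert e F) (?A - {e}))"
      unfolding kruskal_mean_rec[OF A(2) False] p_def q_def
      by (auto intro!: sum.cong simp: active_def)
    have "a * ?W l F R - exp \<epsilon> * b * ?W l' F R =
        (\<Sum>e\<in>?A. (a * p e) * ?W l (insert e F) (?A - {e}) - exp \<epsilon> * (b * q e) * ?W l' (insert e F) (?A - {e}))"
      unfolding act W by (simp add: sum_subtractf sum_distrib_left ac_simps)
    also have "\<dots> \<le> (\<Sum>e\<in>?A. ?C * ((a * p e) powr \<alpha> * (b * q e) powr (1 - \<alpha>)) * ?B ^ k)"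
    proof (rule sum_mono)
      fix e assume e: "e \<in> ?A"
      have "(a * p e) * ?W l (insert e F) (?A - {e}) - exp \<epsilon> * (b * q e) * ?W l' (insert e F) (?A - {e})
        \<le> ?C * ((a * p e) powr \<alpha> * (b * q e) powr (1 - \<alpha>)) * ?B ^ card (components G (insert e F))"
        using e A less.prems pq[OF e] by (intro less.hyps lt) auto
      also have "\<dots> \<le> ?C * ((a * p e) powr \<alpha> * (b * q e) powr (1 - \<alpha>)) * ?B ^ k"
        using lt[OF e] k by (intro mult_left_mono power_increasing) auto
      finally show "(a * p e) * ?W l (insert e F) (?A - {e}) - exp \<epsilon> * (b * q e) * ?W l' (insert e F) (?A - {e})
        \<le> ?C * ((a * p e) powr \<alpha> * (b * q e) powr (1 - \<alpha>)) * ?B ^ k" .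
    qed
    \<comment> \<open>The moment factors into that of the earlier choices and that of the present
      choice; the latter costs one factor \<open>?B\<close>.\<close>
    also have "\<dots> = ?C * (a powr \<alpha> * b powr (1 - \<alpha>)) * ?B ^ k * (\<Sum>e\<in>?A. p e powr \<alpha> * q e powr (1 - \<alpha>))"
      unfolding sum_distrib_left using less.prems pq
      by (intro sum.cong refl) (simp add: powr_mult less_imp_le)
    also have "\<dots> \<le> ?C * (a powr \<alpha> * b powr (1 - \<alpha>)) * ?B ^ k * ?B"
      unfolding p_def q_def using A l c \<alpha> False
      by (intro mult_left_mono normalized_moment_le) auto
    finally show ?thesis by (simp add: k ac_simps)
  qed
qed

text \<open>The order \<alpha> is chosen so that \<epsilon> (\<alpha> - 1) = 2 L. Since \<alpha>
  \<le> (K + 2) L / \<epsilon>, the value of \<eta> makes the moments of n draws contribute at most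
  L to the exponent, and exp (- L) remains.\<close>

lemma kruskal_mean_private:
  assumes G: "simple_graph G" "1 \<le> nverts G"
    and l: "\<And>e. e \<in> edges G \<Longrightarrow> 0 < l e" "\<And>e. e \<in> edges G \<Longrightarrow> 0 < l' e"
    and c: "\<And>e. e \<in> edges G \<Longrightarrow> l e \<le> exp \<eta> * l' e" "\<And>e. e \<in> edges G \<Longrightarrow> l' e \<le> exp \<eta> * l e"
    and h: "\<And>T. 0 \<le> h T" "\<And>T. h T \<le> 1"
    and K: "0 < K" "0 < \<epsilon>" "0 < L" "\<epsilon> \<le> K * L"
    and \<eta>: "\<eta> = \<epsilon> / (2 * (K + 2) * sqrt L * sqrt (nverts G))"
  shows "kruskal_mean G h l {} (edges G) \<le> exp \<epsilon> * kruskal_mean G h l' {} (edges G) + exp (- L)"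
proof -
  define \<alpha> where "\<alpha> = 1 + 2 * L / \<epsilon>"
  have \<alpha>1: "1 \<le> \<alpha>" using K by (simp add: \<alpha>_def)
  have "\<alpha> \<le> (K + 2) * L / \<epsilon>" using K by (simp add: \<alpha>_def field_simps)
  then have "\<alpha>\<^sup>2 \<le> ((K + 2) * L / \<epsilon>)\<^sup>2" using \<alpha>1 by (intro power_mono) auto
  moreover have \<eta>2: "4 * \<eta>\<^sup>2 * nverts G = \<epsilon>\<^sup>2 / ((K + 2)\<^sup>2 * L)"
  proof -
    have "\<eta>\<^sup>2 = \<epsilon>\<^sup>2 / (4 * (K + 2)\<^sup>2 * L * nverts G)"
      unfolding \<eta> using K by (simp only: power_divide power_mult_distrib) simp
    then show ?thesis using G by simp
  qed
  ultimately have "\<alpha>\<^sup>2 * (4 * \<eta>\<^sup>2 * nverts G) \<le> ((K + 2) * L / \<epsilon>)\<^sup>2 * (\<epsilon>\<^sup>2 / ((K + 2)\<^sup>2 * L))"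
    using K by (simp only: \<eta>2) (intro mult_right_mono, auto)
  also have "\<dots> = L"
    using K by (simp add: power_divide power_mult_distrib) (simp add: power2_eq_square)
  finally have le: "nverts G * (4 * \<alpha>\<^sup>2 * \<eta>\<^sup>2) \<le> L" by (simp add: ac_simps)
  \<comment> \<open>No choice has been made yet, hence \<open>a = b = 1\<close>.\<close>
  have "1 * kruskal_mean G h l {} (edges G) - exp \<epsilon> * 1 * kruskal_mean G h l' {} (edges G)
    \<le> exp (- \<epsilon> * (\<alpha> - 1)) * (1 powr \<alpha> * 1 powr (1 - \<alpha>)) * exp (4 * \<alpha>\<^sup>2 * \<eta>\<^sup>2) ^ card (components G {})"
    by (rule kruskal_mean_composition) (use assms \<alpha>1 in auto)
  also have "\<dots> = exp (- \<epsilon> * (\<alpha> - 1) + nverts G * (4 * \<alpha>\<^sup>2 * \<eta>\<^sup>2))"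
    by (simp add: card_components_empty mult_exp_exp flip: exp_of_nat_mult)
  also have "\<dots> \<le> exp (- L)"
    using K le by (simp add: \<alpha>_def)
  finally show ?thesis by simp
qed

section \<open>Exponential clocks\<close>

abbreviation unif :: "real measure" where
  "unif \<equiv> restrict_space lborel {0..1}"

lemma prob_space_unif: "prob_space unif"
  by (rule prob_spaceI) (simp add: emeasure_restrict_space space_restrict_space)

interpretation unif: product_prob_space "\<lambda>_. unif" UNIV
  by (rule product_prob_spaceI) (rule prob_space_unif)

interpretation coins: prob_space coins
  unfolding coins_def by (rule prob_space_PiM) (rule prob_space_unif)

lemma space_coins: "space coins = {\<omega>. \<forall>i. \<omega> i \<in> {0..1}}"
  by (auto simp: coins_def space_PiM space_restrict_space)

lemma measurable_unif_borel [measurable]: "(\<lambda>x. x) \<in> measurable unif borel"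
  by (simp add: measurable_restrict_space1)

lemma measurable_PiM_unif [measurable]:
  assumes "i \<in> I"
  shows "(\<lambda>\<omega>. \<omega> i) \<in> borel_measurable (PiM I (\<lambda>_. unif))"
  using measurable_compose[OF measurable_component_singleton[OF assms] measurable_unif_borel] by simp

lemma measurable_coins [measurable]: "(\<lambda>\<omega>. \<omega> i) \<in> borel_measurable coins"
  unfolding coins_def by measurable

text \<open>The clock of \<open>e\<close> is an exponential variable obtained from a uniform number
  by inversion. The start \<open>s\<close> is there for the induction. For \<open>s = 0\<close> the
  boundary values 0 and 1, whose clocks evaluate to 0, lose the race.\<close>

fun race :: "(nat \<Rightarrow> real) \<Rightarrow> real \<Rightarrow> nat list \<Rightarrow> (nat \<Rightarrow> real) \<Rightarrow> bool" where
  "race l s [] x \<longleftrightarrow> True"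
| "race l s (e # es) x \<longleftrightarrow> s < - ln (x e) / l e \<and> race l (- ln (x e) / l e) es x"

lemma race_cong: "(\<And>e. e \<in> set p \<Longrightarrow> x e = y e) \<Longrightarrow> race l s p x = race l s p y"
  by (induction p arbitrary: s) auto

lemma race_iff_sorted: "race l s p x \<longleftrightarrow> sorted_wrt (<) (s # map (\<lambda>e. - ln (x e) / l e) p)"
  by (induction p arbitrary: s) (auto intro: less_trans)

text \<open>Makes the events of different orders disjoint.\<close>

lemma race_unique:
  assumes "race l s p x" "race l s q x" "p \<in> permutations_of_set R" "q \<in> permutations_of_set R"
  shows "p = q"
proof -
  let ?c = "\<lambda>e. - ln (x e) / l e"
  have s: "sorted_wrt (<) (map ?c p)" "sorted_wrt (<) (map ?c q)"
    using assms(1,2) by (auto simp: race_iff_sorted)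
  have set: "set p = R" "set q = R" "distinct p" "distinct q" using assms by (auto dest: permutations_of_setD)
  have "map ?c p = map ?c q"
    using s set by (intro strict_sorted_equal) auto
  moreover have "inj_on ?c R"
    using s(1) set by (auto simp: strict_sorted_iff distinct_map)
  ultimately show ?thesis using set by (auto intro: map_inj_on)
qed

text \<open>The start is a function of the sample because the recursion replaces it by a
  clock.\<close>

lemma pred_race [measurable]:
  assumes "set p \<subseteq> I" "s \<in> borel_measurable (PiM I (\<lambda>_. unif))"
  shows "Measurable.pred (PiM I (\<lambda>_. unif)) (\<lambda>x. race l (s x) p x)"
  using assms
proof (induction p arbitrary: s)
  case Nil
  show ?case unfolding race.simps by (rule measurable_const) simp
next
  case (Cons e p)
  have [measurable]: "e \<in> I" using Cons.prems(1) by simp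
  have m: "(\<lambda>x. - ln (x e) / l e) \<in> borel_measurable (PiM I (\<lambda>_. unif))" by measurable
  have sub: "set p \<subseteq> I" using Cons.prems(1) by simp
  show ?case
    unfolding race.simps
    by (intro pred_intros_logic borel_measurable_pred_less m Cons.prems(2) Cons.IH[OF sub m])
qed

lemma nn_integral_powr_Icc:
  assumes "0 \<le> b" "-1 < a"
  shows "(\<integral>\<^sup>+u. ennreal (u powr a) * indicator {0..b} u \<partial>lborel) = ennreal (b powr (a + 1) / (a + 1))"
  using assms by (intro nn_integral_has_integral_lebesgue' has_integral_powr_from_0) auto

text \<open>The exponential factor is the probability that no clock has rung before
  \<open>s\<close>; this is memorylessness in a form fit for induction on the order.\<close>

lemma emeasure_race:
  assumes "distinct p" "\<And>e. e \<in> set p \<Longrightarrow> 0 < l e" "0 \<le> s"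
  shows "emeasure (PiM (set p) (\<lambda>_. unif)) {x \<in> space (PiM (set p) (\<lambda>_. unif)). race l s p x} =
    ennreal (exp (- s * sum l (set p)) * plackett_luce l p)"
  using assms
proof (induction p arbitrary: s)
  case Nil
  then show ?case by (simp add: PiM_empty)
next
  case (Cons e p)
  let ?P = "\<lambda>I. PiM I (\<lambda>_::nat. unif)" and ?c = "\<lambda>u. - ln u / l e" and ?b = "exp (- s * l e)"
  define S where "S = sum l (set p)"
  have le: "0 < l e" using Cons.prems(2) by simp
  have S: "0 \<le> S" unfolding S_def using Cons.prems by (intro sum_nonneg) (auto intro: less_imp_le)
  have pl: "0 \<le> plackett_luce l p" using Cons.prems by (intro plackett_luce_nonneg) auto
  have "emeasure (?P (set (e # p))) {x \<in> space (?P (set (e # p))). race l s (e # p) x} =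
      (\<integral>\<^sup>+x. indicator {x. race l s (e # p) x} x \<partial>?P (insert e (set p)))"
  proof -
    have "{x \<in> space (?P (set (e # p))). race l s (e # p) x} \<in> sets (?P (set (e # p)))"
      by (intro predE pred_race) auto
    from nn_integral_indicator[OF this, symmetric] show ?thesis
      by (auto intro!: nn_integral_cong simp: indicator_def simp del: race.simps)
  qed
  \<comment> \<open>Fubini: the number of the first edge becomes the outer variable, and its clock
    is the start for the others.\<close>
  also have "\<dots> = (\<integral>\<^sup>+u. (\<integral>\<^sup>+x. indicator {x. race l s (e # p) x} (x(e := u)) \<partial>?P (set p)) \<partial>unif)"
    using Cons.prems
    by (intro unif.product_nn_integral_insert_rev)
       (auto simp del: race.simps intro!: borel_measurable_indicator' pred_race)
  also have "\<dots> = (\<integral>\<^sup>+u. indicator {s<..} (?c u) * ennreal (exp (- ?c u * S) * plackett_luce l p) \<partial>unif)"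
  proof (rule nn_integral_cong)
    fix u
    have "(\<integral>\<^sup>+x. indicator {x. race l s (e # p) x} (x(e := u)) \<partial>?P (set p)) =
        (\<integral>\<^sup>+x. indicator {s<..} (?c u) * indicator {x \<in> space (?P (set p)). race l (?c u) p x} x \<partial>?P (set p))"
    proof (rule nn_integral_cong)
      fix x assume "x \<in> space (?P (set p))"
      moreover have "race l (?c u) p (x(e := u)) = race l (?c u) p x"
        using Cons.prems by (intro race_cong) auto
      ultimately show "indicator {x. race l s (e # p) x} (x(e := u)) =
        (indicator {s<..} (?c u) * indicator {x \<in> space (?P (set p)). race l (?c u) p x} x :: ennreal)"
        by (auto simp: indicator_def)
    qed
    also have "\<dots> = indicator {s<..} (?c u) * emeasure (?P (set p)) {x \<in> space (?P (set p)). race l (?c u) p x}"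
      by (subst nn_integral_cmult_indicator) (auto intro!: predE pred_race)
    also have "\<dots> = indicator {s<..} (?c u) * ennreal (exp (- ?c u * S) * plackett_luce l p)"
      using Cons.IH[of "?c u"] Cons.prems by (cases "s < ?c u") (auto simp: S_def)
    finally show "(\<integral>\<^sup>+x. indicator {x. race l s (e # p) x} (x(e := u)) \<partial>?P (set p)) = \<dots>" .
  qed
  also have "\<dots> = (\<integral>\<^sup>+u. indicator {s<..} (?c u) * ennreal (exp (- ?c u * S) * plackett_luce l p) * indicator {0..1} u \<partial>lborel)"
    by (subst nn_integral_restrict_space) (auto simp: ac_simps)
  also have "\<dots> = (\<integral>\<^sup>+u. ennreal (plackett_luce l p) * (ennreal (u powr (S / l e)) * indicator {0..?b} u) \<partial>lborel)"
  proof (rule nn_integral_cong_AE)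
    \<comment> \<open>Two points are left out: \<open>?b\<close>, which the closed interval contains
      but the strict race excludes, and 0, where ln takes a default value.\<close>
    show "AE u in lborel. indicator {s<..} (?c u) * ennreal (exp (- ?c u * S) * plackett_luce l p) * indicator {0..1} u =
      ennreal (plackett_luce l p) * (ennreal (u powr (S / l e)) * indicator {0..?b} u)"
      using AE_lborel_singleton[of ?b] AE_lborel_singleton[of 0]
    proof eventually_elim
      case (elim u)
      have "0 \<le> s * l e" using le Cons.prems(3) by simp
      then have b1: "?b \<le> 1" by simp
      show ?case
      proof (cases "0 < u")
        case True
        have "s < ?c u \<longleftrightarrow> ln u < - s * l e"
          using le by (simp add: field_simps) linarith
        also have "\<dots> \<longleftrightarrow> u < ?b" using True by (metis exp_less_cancel_iff exp_ln)
        finally have 1: "s < ?c u \<longleftrightarrow> u < ?b" .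
        have b2: "u < ?b \<Longrightarrow> u \<le> 1" using b1 by linarith
        have 2: "exp (- ?c u * S) = u powr (S / l e)"
          using True by (simp add: powr_def field_simps)
        show ?thesis
          using 1 b2 elim True pl unfolding 2
          by (cases "u < ?b") (auto simp: indicator_def ennreal_mult' mult.commute)
      qed (use elim in \<open>auto simp: indicator_def\<close>)
    qed
  qed
  also have "\<dots> = ennreal (plackett_luce l p) * ennreal (?b powr (S / l e + 1) / (S / l e + 1))"
  proof -
    have "-1 < S / l e" using S le by (intro less_le_trans[OF _ divide_nonneg_pos]) auto
    then show ?thesis using nn_integral_powr_Icc[of ?b "S / l e"] by (subst nn_integral_cmult) auto
  qed
  also have "\<dots> = ennreal (exp (- s * sum l (set (e # p))) * plackett_luce l (e # p))"
  proof -
    \<comment> \<open>The power at the upper limit is the survival factor of all clocks together,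
      and the denominator of the antiderivative is the Plackett--Luce factor of
      \<open>e\<close>.\<close>
    have "?b powr (S / l e + 1) = exp (- s * (l e + S))"
      using le by (simp add: powr_def field_simps)
    moreover have "1 / (S / l e + 1) = l e / (l e + S)" using le S by (simp add: field_simps)
    ultimately have "?b powr (S / l e + 1) / (S / l e + 1) = exp (- s * (l e + S)) * (l e / (l e + S))"
      by (metis mult.right_neutral times_divide_eq_right)
    then show ?thesis
      using pl Cons.prems le S by (simp add: S_def ac_simps flip: ennreal_mult')
  qed
  finally show ?case .
qed

lemma sets_race: "{\<omega> \<in> space coins. race l s p \<omega>} \<in> sets coins"
  unfolding coins_def by (intro predE pred_race) auto

text \<open>Projection to the coordinates in \<open>p\<close> carries the result from the finite
  product to the infinite sequence; at start 0 the survival factor is 1.\<close>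

lemma prob_race:
  assumes "distinct p" "\<And>e. e \<in> set p \<Longrightarrow> 0 < l e"
  shows "coins.prob {\<omega> \<in> space coins. race l 0 p \<omega>} = plackett_luce l p"
proof -
  let ?P = "PiM (set p) (\<lambda>_. unif)" and ?A = "{x \<in> space (PiM (set p) (\<lambda>_. unif)). race l 0 p x}"
  have "ennreal (plackett_luce l p) = emeasure ?P ?A"
    using emeasure_race[of p l 0] assms by simp
  also have "\<dots> = emeasure (distr coins ?P (\<lambda>\<omega>. restrict \<omega> (set p))) ?A"
    unfolding coins_def by (subst unif.distr_PiM_restrict_finite) auto
  also have "\<dots> = emeasure coins ((\<lambda>\<omega>. restrict \<omega> (set p)) -` ?A \<inter> space coins)"
    unfolding coins_def by (intro emeasure_distr predE pred_race measurable_restrict_subset) auto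
  also have "(\<lambda>\<omega>. restrict \<omega> (set p)) -` ?A \<inter> space coins = {\<omega> \<in> space coins. race l 0 p \<omega>}"
    using race_cong[of p "restrict _ (set p)"]
    by (auto simp: space_coins space_PiM space_restrict_space)
  finally show ?thesis
    using plackett_luce_nonneg[of p l] assms(2) by (simp add: coins.emeasure_eq_measure)
qed

text \<open>The disjoint strict orders bound both \<open>Q\<close> and its complement from below.
  These bounds add up to 1, so both are equalities, whatever \<open>Q\<close> contains among the
  ties.\<close>

lemma prob_by_race:
  assumes R: "finite R" "\<And>e. e \<in> R \<Longrightarrow> 0 < l e" and Q: "Q \<in> sets coins"
    and eq: "\<And>p \<omega>. p \<in> permutations_of_set R \<Longrightarrow> \<omega> \<in> space coins \<Longrightarrow> race l 0 p \<omega> \<Longrightarrow> \<omega> \<in> Q \<longleftrightarrow> P p"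
  shows "coins.prob Q = (\<Sum>p\<in>permutations_of_set R. plackett_luce l p * of_bool (P p))"
proof -
  let ?E = "\<lambda>p. {\<omega> \<in> space coins. race l 0 p \<omega>}" and ?R = "permutations_of_set R"
  have fin: "finite ?R" using R by simp
  have E: "coins.prob (?E p) = plackett_luce l p" if "p \<in> ?R" for p
    using that R(2) by (intro prob_race) (auto dest: permutations_of_setD)
  have le: "(\<Sum>p\<in>?R. plackett_luce l p * of_bool (P' p)) \<le> coins.prob Q'"
    if "Q' \<in> sets coins" "\<And>p \<omega>. p \<in> ?R \<Longrightarrow> \<omega> \<in> ?E p \<Longrightarrow> P' p \<Longrightarrow> \<omega> \<in> Q'" for P' Q'
  proof -
    have "(\<Sum>p\<in>?R. plackett_luce l p * of_bool (P' p)) = (\<Sum>p\<in>{p\<in>?R. P' p}. coins.prob (?E p))"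
      using fin E by (intro sum.mono_neutral_cong_right) auto
    also have "\<dots> = coins.prob (\<Union>p\<in>{p\<in>?R. P' p}. ?E p)"
      using fin race_unique[of l 0 _ _ _ R] sets_race
      by (intro coins.finite_measure_finite_Union[symmetric]) (auto simp: disjoint_family_on_def)
    also have "\<dots> \<le> coins.prob Q'"
      using that by (intro coins.finite_measure_mono) auto
    finally show ?thesis .
  qed
  have 1: "(\<Sum>p\<in>?R. plackett_luce l p * of_bool (P p)) \<le> coins.prob Q"
    by (rule le) (use Q eq in auto)
  have 2: "(\<Sum>p\<in>?R. plackett_luce l p * of_bool (\<not> P p)) \<le> coins.prob (space coins - Q)"
    by (rule le) (use Q eq in auto)
  have "(\<Sum>p\<in>?R. plackett_luce l p * of_bool (P p)) + (\<Sum>p\<in>?R. plackett_luce l p * of_bool (\<not> P p)) =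
      (\<Sum>p\<in>?R. plackett_luce l p)"
    unfolding sum.distrib[symmetric] by (intro sum.cong) auto
  also have "\<dots> = 1" using R by (intro sum_plackett_luce)
  finally show ?thesis using 1 2 coins.prob_compl[OF Q] by linarith
qed

section \<open>Integrable majorants of the noise\<close>

lemma has_bochner_integral_inverse_sqrt: "has_bochner_integral unif (\<lambda>u. 1 / sqrt u) 2"
proof (rule has_bochner_integral_nn_integral)
  have "(\<integral>\<^sup>+u. ennreal (1 / sqrt u) \<partial>unif) = (\<integral>\<^sup>+u. ennreal (u powr (-1/2)) * indicator {0..1} u \<partial>lborel)"
  proof -
    have "1 / sqrt u = u powr (-1/2)" if "0 \<le> u" for u :: real
      using that powr_minus[of u "1/2"] by (simp add: powr_half_sqrt inverse_eq_divide)
    then show ?thesis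
      by (subst nn_integral_restrict_space) (auto intro!: nn_integral_cong simp: indicator_def)
  qed
  also have "\<dots> = ennreal 2" by (subst nn_integral_powr_Icc) auto
  finally show "(\<integral>\<^sup>+u. ennreal (1 / sqrt u) \<partial>unif) = ennreal 2" .
qed auto

text \<open>For the other tail of the noise, where the uniform number is near 1.\<close>

lemma has_bochner_integral_inverse_sqrt_reflect: "has_bochner_integral unif (\<lambda>u. 1 / sqrt (1 - u)) 2"
proof (rule has_bochner_integral_nn_integral)
  have "(\<integral>\<^sup>+u. ennreal (1 / sqrt (1 - u)) \<partial>unif) = (\<integral>\<^sup>+u. ennreal (1 / sqrt (1 - u)) * indicator {0..1} u \<partial>lborel)"
    by (subst nn_integral_restrict_space) auto
  also have "\<dots> = (\<integral>\<^sup>+u. ennreal (1 / sqrt u) * indicator {0..1} u \<partial>lborel)"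
    by (subst nn_integral_real_affine[where c = "-1" and t = 1])
       (auto intro!: nn_integral_cong simp: indicator_def)
  also have "\<dots> = (\<integral>\<^sup>+u. ennreal (1 / sqrt u) \<partial>unif)"
    by (subst nn_integral_restrict_space) auto
  also have "\<dots> = ennreal 2"
    using has_bochner_integral_inverse_sqrt
    by (subst nn_integral_eq_integral) (auto simp: has_bochner_integral_iff)
  finally show "(\<integral>\<^sup>+u. ennreal (1 / sqrt (1 - u)) \<partial>unif) = ennreal 2" .
qed auto

lemma has_bochner_integral_coins:
  assumes "has_bochner_integral unif f (x::real)"
  shows "has_bochner_integral coins (\<lambda>\<omega>. f (\<omega> e)) x"
proof -
  have "distr coins unif (\<lambda>\<omega>. \<omega> e) = unif"
    unfolding coins_def by (rule unif.PiM_component) simp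
  moreover have "(\<lambda>\<omega>. \<omega> e) \<in> measurable coins unif" unfolding coins_def by measurable
  ultimately show ?thesis
    using assms integrable_distr_eq[of "\<lambda>\<omega>. \<omega> e" coins unif f] integral_distr[of "\<lambda>\<omega>. \<omega> e" coins unif f]
    by (simp add: has_bochner_integral_iff borel_measurable_integrable)
qed

section \<open>The mechanism as a machine program\<close>

fun shift_instr :: "nat \<Rightarrow> instr \<Rightarrow> instr" where
  "shift_instr d (Jump l) = Jump (l + d)"
| "shift_instr d (JumpNLess x y l) = JumpNLess x y (l + d)"
| "shift_instr d (JumpRLess x y l) = JumpRLess x y (l + d)"
| "shift_instr d i = i"

text \<open>A simulation relation in the form of a function: the code has moved by \<open>d\<close>,
  and \<open>k\<close> random numbers are used up.\<close>

definition embed :: "nat \<Rightarrow> nat \<Rightarrow> config \<Rightarrow> config" where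
  "embed d k s = s\<lparr>pc := pc s + d, draws := draws s + k\<rparr>"

lemma exec_shift_instr:
  "exec \<omega> (shift_instr d i) (embed d k s) = embed d k (exec (\<lambda>j. \<omega> (j + k)) i s)"
  by (cases i) (auto simp: embed_def next_pc_def)

text \<open>Halting is covered as well: the shifted counter leaves the whole program exactly when
  the original one leaves \<open>A\<close>.\<close>

lemma step_append_shift:
  assumes "length P = d"
  shows "step (P @ map (shift_instr d) A) \<omega> (embed d k s) = embed d k (step A (\<lambda>j. \<omega> (j + k)) s)"
proof -
  have "pc (embed d k s) = pc s + d" by (simp add: embed_def)
  then show ?thesis
    using assms by (auto simp: step_def halted_def nth_append exec_shift_instr)
qed

lemma funpow_step_append_shift:
  assumes "length P = d"
  shows "(step (P @ map (shift_instr d) A) \<omega> ^^ n) (embed d k s) =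
    embed d k ((step A (\<lambda>j. \<omega> (j + k)) ^^ n) s)"
  by (induction n) (simp_all add: step_append_shift[OF assms])

lemma run_add: "run p G w \<omega> (j + k) = (step p \<omega> ^^ k) (run p G w \<omega> j)"
  by (simp add: run_def funpow_add[of k j, symmetric] add.commute flip: comp_apply[of "step p \<omega> ^^ k"])

lemma run_halted:
  assumes "halts_within p G w \<omega> j" "j \<le> k"
  shows "run p G w \<omega> k = run p G w \<omega> j"
proof -
  have "(step p \<omega> ^^ i) (run p G w \<omega> j) = run p G w \<omega> j" for i
    using assms(1) by (induction i) (auto simp: step_def halts_within_def)
  then show ?thesis using run_add[of p G w \<omega> j "k - j"] assms(2) by simp
qed

lemma halts_within_mono: "halts_within p G w \<omega> j \<Longrightarrow> j \<le> k \<Longrightarrow> halts_within p G w \<omega> k"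
  by (metis halts_within_def run_halted)

lemma tree_output_eq:
  assumes "halts_within p G w \<omega> k"
  shows "tree_output p G w \<omega> = nmem (run p G w \<omega> k) ` {1..nmem (run p G w \<omega> k) 0}"
proof -
  have "run p G w \<omega> k = run p G w \<omega> (LEAST k. halts_within p G w \<omega> k)"
    by (rule run_halted) (fact LeastI[of "halts_within p G w \<omega>", OF assms],
      fact Least_le[of "halts_within p G w \<omega>", OF assms])
  then show ?thesis by (simp add: tree_output_def Let_def)
qed

text \<open>The noise is a negated Gumbel variable scaled by \<sigma> = sqrt n * c. The constant
  \<open>c\<close> is built into the program, while sqrt n is computed at run time, as one program
  serves all graphs.\<close>

definition noisy_weight :: "real \<Rightarrow> topology \<Rightarrow> (nat \<Rightarrow> real) \<Rightarrow> (nat \<Rightarrow> real) \<Rightarrow> nat \<Rightarrow> real" where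
  "noisy_weight c G w \<omega> e = w e + ln (- ln (\<omega> e)) * (sqrt (nverts G) * c)"

text \<open>The first random number is discarded so that edge \<open>e\<close> receives the number with index \<open>e\<close>;
  the registers are cleared at the end because the given program expects them to be \<open>0\<close>.\<close>

definition perturb :: "real \<Rightarrow> program" where
  "perturb c = [
     Sample 1,
     NLoad 1 0,
     ROfNat 1 1,
     RElem Sqrt 1 1,
     RConst 2 c,
     RArith Times 1 1 2,
     NConst 2 1,
     NLoad 1 2,
     NConst 3 1,
     JumpNLess 1 3 20,
     Sample 2,
     RElem Ln 2 2,
     RArith Minus 2 3 2,
     RElem Ln 2 2,
     RArith Times 2 2 1,
     RLoad 4 3,
     RArith Plus 2 4 2,
     RStore 3 2,
     NArith Plus 3 3 2,
     Jump 9,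
     NConst 1 0, NConst 2 0, NConst 3 0, RConst 1 0, RConst 2 0, RConst 4 0]"

definition mechanism :: "real \<Rightarrow> program \<Rightarrow> program" where
  "mechanism c A = perturb c @ map (shift_instr 26) A"

lemma length_perturb: "length (perturb c) = 26"
  by (simp add: perturb_def)

lemma step_mechanism:
  "pc s < 26 \<Longrightarrow> step (mechanism c A) \<omega> s = exec \<omega> (perturb c ! pc s) s"
  by (simp add: step_def halted_def mechanism_def nth_append length_perturb)

text \<open>The values \<open>a\<close> and \<open>b\<close> are leftovers of the previous round.
  Real register 3 is never written and supplies the 0 from which the logarithm is
  subtracted.\<close>

definition loop_state ::
    "real \<Rightarrow> topology \<Rightarrow> (nat \<Rightarrow> real) \<Rightarrow> (nat \<Rightarrow> real) \<Rightarrow> nat \<Rightarrow> real \<Rightarrow> real \<Rightarrow> config" where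
  "loop_state c G w \<omega> j a b =
     \<lparr>pc = 9, nreg = (\<lambda>_. 0)(1 := nedges G, 2 := 1, 3 := Suc j),
      rreg = (\<lambda>_. 0)(1 := sqrt (nverts G) * c, 2 := a, 4 := b),
      nmem = nmem (initial G w),
      rmem = (\<lambda>e. if e \<in> {1..j} then noisy_weight c G w \<omega> e else rmem (initial G w) e),
      draws = Suc j\<rparr>"

lemma run_perturb_init:
  "run (mechanism c A) G w \<omega> 9 = loop_state c G w \<omega> 0 c 0"
proof -
  define N where "N = nmem (initial G w)"
  define R where "R = rmem (initial G w)"
  have N: "N 0 = nverts G" "N (Suc 0) = nedges G" by (simp_all add: N_def initial_def)
  have i: "initial G w = \<lparr>pc = 0, nreg = (\<lambda>_. 0), rreg = (\<lambda>_. 0), nmem = N, rmem = R, draws = 0\<rparr>"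
    by (simp add: initial_def N_def R_def)
  have 9: "9 = Suc (Suc (Suc (Suc (Suc (Suc (Suc (Suc (Suc 0))))))))" by simp
  show ?thesis
    unfolding run_def loop_state_def N_def[symmetric] R_def[symmetric] i 9 funpow_Suc_right
    by (simp add: step_mechanism perturb_def next_pc_def N fun_eq_iff)
qed

lemma funpow_loop:
  assumes "j < nedges G"
  shows "(step (mechanism c A) \<omega> ^^ 11) (loop_state c G w \<omega> j a b) = loop_state c G w \<omega> (Suc j)
    (noisy_weight c G w \<omega> (Suc j)) (w (Suc j))"
proof -
  have R: "rmem (initial G w) (Suc j) = w (Suc j)" using assms by (simp add: initial_def edges_def)
  have 11: "11 = Suc (Suc (Suc (Suc (Suc (Suc (Suc (Suc (Suc (Suc (Suc 0))))))))))" by simp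
  show ?thesis
    using assms
    unfolding loop_state_def 11 funpow_Suc_right
    by (simp add: step_mechanism perturb_def next_pc_def R noisy_weight_def fun_eq_iff)
qed

lemma run_perturb_loop:
  "j \<le> nedges G \<Longrightarrow> \<exists>a b. run (mechanism c A) G w \<omega> (9 + 11 * j) = loop_state c G w \<omega> j a b"
proof (induction j)
  case 0
  then show ?case using run_perturb_init[of c A G w \<omega>] by auto
next
  case (Suc j)
  then obtain a b where "run (mechanism c A) G w \<omega> (9 + 11 * j) = loop_state c G w \<omega> j a b" by auto
  then have "run (mechanism c A) G w \<omega> ((9 + 11 * j) + 11) =
      loop_state c G w \<omega> (Suc j) (noisy_weight c G w \<omega> (Suc j)) (w (Suc j))"
    unfolding run_add[of _ _ _ _ "9 + 11 * j" 11] using Suc.prems by (simp add: funpow_loop)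
  then show ?case by (intro exI) (simp add: algebra_simps)
qed

lemma run_perturb:
  "run (mechanism c A) G w \<omega> (16 + 11 * nedges G) =
    embed 26 (Suc (nedges G)) (initial G (noisy_weight c G w \<omega>))"
proof -
  let ?m = "nedges G"
  obtain a b where ab: "run (mechanism c A) G w \<omega> (9 + 11 * ?m) = loop_state c G w \<omega> ?m a b"
    using run_perturb_loop by blast
  have 7: "7 = Suc (Suc (Suc (Suc (Suc (Suc (Suc 0))))))" by simp
  \<comment> \<open>Seven steps remain: the jump out of the loop and six instructions that clear
    registers.\<close>
  have "run (mechanism c A) G w \<omega> ((9 + 11 * ?m) + 7) =
      embed 26 (Suc (nedges G)) (initial G (noisy_weight c G w \<omega>))"
    unfolding run_add[of _ _ _ _ "9 + 11 * ?m" 7]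
    unfolding ab loop_state_def 7 funpow_Suc_right
    by (simp add: step_mechanism perturb_def next_pc_def fun_eq_iff embed_def initial_def edges_def)
  then show ?thesis by (simp add: algebra_simps)
qed

definition skip_draws :: "topology \<Rightarrow> (nat \<Rightarrow> real) \<Rightarrow> nat \<Rightarrow> real" where
  "skip_draws G \<omega> i = \<omega> (i + Suc (nedges G))"

lemma run_mechanism:
  "run (mechanism c A) G w \<omega> (16 + 11 * nedges G + k) =
    embed 26 (Suc (nedges G)) (run A G (noisy_weight c G w \<omega>) (skip_draws G \<omega>) k)"
  unfolding run_add[of _ _ _ _ "16 + 11 * nedges G" k] run_perturb
  unfolding mechanism_def funpow_step_append_shift[OF length_perturb] run_def skip_draws_def ..

lemma halts_within_mechanism:
  assumes "halts_within A G (noisy_weight c G w \<omega>) (skip_draws G \<omega>) k"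
  shows "halts_within (mechanism c A) G w \<omega> (16 + 11 * nedges G + k)"
  using assms unfolding halts_within_def run_mechanism
  by (simp add: halted_def embed_def mechanism_def length_perturb)

lemma tree_output_mechanism:
  assumes "halts_within A G (noisy_weight c G w \<omega>) (skip_draws G \<omega>) k"
  shows "tree_output (mechanism c A) G w \<omega> = tree_output A G (noisy_weight c G w \<omega>) (skip_draws G \<omega>)"
  unfolding tree_output_eq[OF assms] tree_output_eq[OF halts_within_mechanism[OF assms]] run_mechanism
  by (simp add: embed_def)

section \<open>Measurability of runs\<close>

abbreviation nat_measurable :: "((nat \<Rightarrow> real) \<Rightarrow> nat) \<Rightarrow> bool" where
  "nat_measurable f \<equiv> f \<in> measurable coins (count_space UNIV)"

text \<open>Stated for each component and each memory cell, so that no sigma-algebra on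
  configurations has to be chosen.\<close>

definition config_measurable :: "((nat \<Rightarrow> real) \<Rightarrow> config) \<Rightarrow> bool" where
  "config_measurable S \<longleftrightarrow>
     nat_measurable (\<lambda>\<omega>. pc (S \<omega>)) \<and> nat_measurable (\<lambda>\<omega>. draws (S \<omega>)) \<and>
     (\<forall>i. nat_measurable (\<lambda>\<omega>. nreg (S \<omega>) i)) \<and> (\<forall>i. nat_measurable (\<lambda>\<omega>. nmem (S \<omega>) i)) \<and>
     (\<forall>i. (\<lambda>\<omega>. rreg (S \<omega>) i) \<in> borel_measurable coins) \<and>
     (\<forall>i. (\<lambda>\<omega>. rmem (S \<omega>) i) \<in> borel_measurable coins)"

lemma nat_measurable_compose:
  assumes "nat_measurable f" "space N = UNIV"
  shows "(\<lambda>\<omega>. g (f \<omega>)) \<in> measurable coins N"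
  by (rule measurable_compose[OF assms(1)]) (simp add: measurable_count_space_eq1 assms(2))

lemma nat_measurable_binary:
  assumes "nat_measurable f" "nat_measurable g"
  shows "(\<lambda>\<omega>. h (f \<omega>) (g \<omega>)) \<in> measurable coins (count_space UNIV)"
proof -
  have "(\<lambda>\<omega>. h i (g \<omega>)) \<in> measurable coins (count_space UNIV)" for i
    by (rule nat_measurable_compose[OF assms(2), where g = "h i"]) simp
  then show ?thesis
    by (rule measurable_compose_countable[where f = "\<lambda>i \<omega>. h i (g \<omega>)", OF _ assms(1)])
qed

lemma config_measurable_exec:
  assumes "config_measurable S"
  shows "config_measurable (\<lambda>\<omega>. exec \<omega> i (S \<omega>))"
proof -
  have m: "nat_measurable (\<lambda>\<omega>. pc (S \<omega>))" "nat_measurable (\<lambda>\<omega>. draws (S \<omega>))"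
    "\<And>i. nat_measurable (\<lambda>\<omega>. nreg (S \<omega>) i)" "\<And>i. nat_measurable (\<lambda>\<omega>. nmem (S \<omega>) i)"
    "\<And>i. (\<lambda>\<omega>. rreg (S \<omega>) i) \<in> borel_measurable coins"
    "\<And>i. (\<lambda>\<omega>. rmem (S \<omega>) i) \<in> borel_measurable coins"
    using assms unfolding config_measurable_def by blast+
  have S: "nat_measurable (\<lambda>\<omega>. Suc (pc (S \<omega>)))" "nat_measurable (\<lambda>\<omega>. Suc (draws (S \<omega>)))"
    by (rule nat_measurable_compose[OF m(1), where g = Suc], simp)
       (rule nat_measurable_compose[OF m(2), where g = Suc], simp)
  have narith: "nat_measurable (\<lambda>\<omega>. narith f (nreg (S \<omega>) y) (nreg (S \<omega>) z))" for f y z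
    by (rule nat_measurable_binary[OF m(3) m(3), where h = "narith f"])
  have eq: "Measurable.pred coins (\<lambda>\<omega>. j = nreg (S \<omega>) x)" for j x
    by (rule nat_measurable_compose[OF m(3), where g = "\<lambda>a. j = a"]) simp
  have less: "Measurable.pred coins (\<lambda>\<omega>. nreg (S \<omega>) x < nreg (S \<omega>) y)" for x y
    by (rule nat_measurable_binary[OF m(3) m(3), where h = "(<)"])
  \<comment> \<open>Indirect addressing is split over the countably many values of the
    address.\<close>
  have nload: "nat_measurable (\<lambda>\<omega>. nmem (S \<omega>) (nreg (S \<omega>) y))" for y
    by (rule measurable_compose_countable[where f = "\<lambda>i \<omega>. nmem (S \<omega>) i"]) (rule m)+
  have rload: "(\<lambda>\<omega>. rmem (S \<omega>) (nreg (S \<omega>) y)) \<in> borel_measurable coins" for y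
    by (rule measurable_compose_countable[where f = "\<lambda>i \<omega>. rmem (S \<omega>) i"]) (rule m)+
  have sample: "(\<lambda>\<omega>. \<omega> (draws (S \<omega>))) \<in> borel_measurable coins"
    by (rule measurable_compose_countable[where f = "\<lambda>i \<omega>. \<omega> i"]) (rule measurable_coins m)+
  have of_nat: "(\<lambda>\<omega>. real (nreg (S \<omega>) y)) \<in> borel_measurable coins" for y
    by (rule nat_measurable_compose[OF m(3), where g = real]) simp
  have rarith: "(\<lambda>\<omega>. rarith f (rreg (S \<omega>) y) (rreg (S \<omega>) z)) \<in> borel_measurable coins" for f y z
    by (cases f; hypsubst; unfold rarith.simps; intro borel_measurable_add borel_measurable_diff
        borel_measurable_times borel_measurable_divide m)
  have elem: "(\<lambda>\<omega>. elem_fun f (rreg (S \<omega>) y)) \<in> borel_measurable coins" for f y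
    by (cases f; hypsubst; unfold elem_fun.simps; intro borel_measurable_ln measurable_compose[OF m(5)]
        borel_measurable_exp borel_measurable_sqrt m)
  have rless: "Measurable.pred coins (\<lambda>\<omega>. rreg (S \<omega>) x < rreg (S \<omega>) y)" for x y
    by (intro borel_measurable_pred_less m)
  note [[simproc del: measurable]]
  show ?thesis
    unfolding config_measurable_def
    by (cases i) (auto simp: next_pc_def fun_upd_def if_distrib[of pc] if_distrib[of draws] if_distrib[of "\<lambda>s. nreg s i" for i]
        if_distrib[of "\<lambda>s. nmem s i" for i] if_distrib[of "\<lambda>s. rreg s i" for i] if_distrib[of "\<lambda>s. rmem s i" for i] intro!: measurable_If[OF _ _ predE] measurable_const m S
        narith eq less nload rload sample of_nat rarith elem rless)
qed

lemma config_measurable_step: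
  assumes "config_measurable S"
  shows "config_measurable (\<lambda>\<omega>. step p \<omega> (S \<omega>))"
proof -
  \<comment> \<open>A step with the program counter frozen at \<open>k\<close>; the instruction then
    no longer depends on the random numbers.\<close>
  define g where "g k \<omega> = (if length p \<le> k then S \<omega> else exec \<omega> (p ! k) (S \<omega>))" for k \<omega>
  have g: "config_measurable (g k)" for k
    unfolding g_def using assms config_measurable_exec[OF assms] by (cases "length p \<le> k") simp_all
  have pc: "nat_measurable (\<lambda>\<omega>. pc (S \<omega>))" using assms unfolding config_measurable_def by blast
  have eq: "step p \<omega> (S \<omega>) = g (pc (S \<omega>)) \<omega>" for \<omega>
    by (simp add: step_def halted_def g_def)
  have c: "(\<lambda>\<omega>. f (g (pc (S \<omega>)) \<omega>)) \<in> measurable coins N"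
    if "\<And>k. (\<lambda>\<omega>. f (g k \<omega>)) \<in> measurable coins N" for N and f :: "config \<Rightarrow> 'b"
    by (rule measurable_compose_countable[where f = "\<lambda>k \<omega>. f (g k \<omega>)", OF that pc])
  show ?thesis
    unfolding config_measurable_def eq
    by (intro conjI allI; rule c) (use g in \<open>unfold config_measurable_def; blast\<close>)+
qed

lemma config_measurable_run: "config_measurable (\<lambda>\<omega>. run p G w \<omega> k)"
proof (induction k)
  case 0
  have "config_measurable (\<lambda>\<omega>. initial G w)"
    unfolding config_measurable_def by (intro conjI allI measurable_const) auto
  then show ?case by (simp add: run_def)
next
  case (Suc k)
  then show ?case using config_measurable_step by (simp add: run_def)
qed

text \<open>A common time bound replaces the halting time, which varies with the outcome, by a fixed
  one. The finite range reduces preimages to single trees, and equality with a tree is a countable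
  conjunction of membership conditions.\<close>

lemma tree_output_measurable:
  assumes "\<And>\<omega>. \<omega> \<in> space coins \<Longrightarrow> halts_within p G w \<omega> k"
    and "\<And>\<omega>. \<omega> \<in> space coins \<Longrightarrow> tree_output p G w \<omega> \<in> \<T>" and "finite \<T>"
  shows "tree_output p G w \<in> measurable coins (count_space UNIV)"
proof -
  let ?N = "\<lambda>\<omega>. nmem (run p G w \<omega> k)"
  have m: "nat_measurable (\<lambda>\<omega>. ?N \<omega> i)" for i
    using config_measurable_run[of p G w k] unfolding config_measurable_def by blast
  have mem: "Measurable.pred coins (\<lambda>\<omega>. e \<in> ?N \<omega> ` {1..?N \<omega> 0})" for e
  proof -
    have "Measurable.pred coins (\<lambda>\<omega>. 1 \<le> j \<and> j \<le> ?N \<omega> 0 \<and> e = ?N \<omega> j)" for j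
      by (intro pred_intros_logic nat_measurable_compose[OF m, where g = "\<lambda>a. j \<le> a"]
          nat_measurable_compose[OF m, where g = "\<lambda>a. e = a"]) auto
    then have "Measurable.pred coins (\<lambda>\<omega>. \<exists>j. 1 \<le> j \<and> j \<le> ?N \<omega> 0 \<and> e = ?N \<omega> j)"
      by (rule pred_intros_countable)
    then show ?thesis by (rule back_subst[of "\<lambda>P. Measurable.pred coins P"]) (auto simp: fun_eq_iff image_iff)
  qed
  have T: "{\<omega> \<in> space coins. tree_output p G w \<omega> = T} \<in> sets coins" for T
  proof -
    have "Measurable.pred coins (\<lambda>\<omega>. \<forall>e. (e \<in> ?N \<omega> ` {1..?N \<omega> 0}) = (e \<in> T))"
      by (intro pred_intros_countable pred_intros_logic mem measurable_const) auto
    then have "{\<omega> \<in> space coins. \<forall>e. (e \<in> ?N \<omega> ` {1..?N \<omega> 0}) = (e \<in> T)} \<in> sets coins"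
      by (rule predE)
    also have "{\<omega> \<in> space coins. \<forall>e. (e \<in> ?N \<omega> ` {1..?N \<omega> 0}) = (e \<in> T)} =
        {\<omega> \<in> space coins. tree_output p G w \<omega> = T}"
    proof (rule Collect_cong, rule conj_cong[OF refl])
      fix \<omega> assume "\<omega> \<in> space coins"
      from tree_output_eq[OF assms(1)[OF this]]
      show "(\<forall>e. (e \<in> ?N \<omega> ` {1..?N \<omega> 0}) = (e \<in> T)) \<longleftrightarrow> tree_output p G w \<omega> = T"
        unfolding set_eq_iff by simp
    qed
    finally show ?thesis .
  qed
  show ?thesis
  proof (rule measurableI)
    fix Z :: "nat set set"
    have "tree_output p G w -` Z \<inter> space coins = (\<Union>T\<in>\<T> \<inter> Z. {\<omega> \<in> space coins. tree_output p G w \<omega> = T})"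
      using assms(2) by auto
    also have "\<dots> \<in> sets coins" using assms(3) T by (intro sets.finite_UN) auto
    finally show "tree_output p G w -` Z \<inter> space coins \<in> sets coins" .
  qed simp
qed

section \<open>Privacy and accuracy\<close>

lemma noisy_weight_sorted:
  assumes \<sigma>: "\<sigma> = sqrt (nverts G) * c" "0 < \<sigma>" and race: "race (\<lambda>e. exp (- w e / \<sigma>)) 0 p \<omega>"
  shows "sorted_wrt (\<lambda>e f. noisy_weight c G w \<omega> e < noisy_weight c G w \<omega> f) p"
proof -
  let ?c = "\<lambda>e. - ln (\<omega> e) / exp (- w e / \<sigma>)"
  have sorted: "sorted_wrt (\<lambda>e f. ?c e < ?c f) p" and pos: "\<And>e. e \<in> set p \<Longrightarrow> 0 < ?c e"
    using race by (auto simp: race_iff_sorted sorted_wrt_map)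
  \<comment> \<open>The logarithm of the rate gives back \<open>w e\<close>. Positivity of the
    clock, which the start 0 provides, keeps ln away from its default values.\<close>
  have noisy: "noisy_weight c G w \<omega> e = \<sigma> * ln (?c e)" if "e \<in> set p" for e
  proof -
    have "0 < ?c e * exp (- w e / \<sigma>)" using pos[OF that] by (intro mult_pos_pos) simp_all
    then have "0 < - ln (\<omega> e)" by simp
    then have "ln (?c e) = ln (- ln (\<omega> e)) - ln (exp (- w e / \<sigma>))" by (intro ln_divide_pos) auto
    then show ?thesis
      unfolding noisy_weight_def \<sigma>(1)[symmetric] using \<sigma>(2) by (simp add: field_simps)
  qed
  show ?thesis
    using sorted
  proof (rule sorted_wrt_mono_rel[rotated])
    fix e f assume ef: "e \<in> set p" "f \<in> set p" "?c e < ?c f"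
    then have "ln (?c e) < ln (?c f)" using pos by (intro ln_less_cancel_iff[THEN iffD2]) auto
    then show "noisy_weight c G w \<omega> e < noisy_weight c G w \<omega> f" 
      unfolding noisy[OF ef(1)] noisy[OF ef(2)] by (rule mult_strict_left_mono[OF _ \<sigma>(2)])
  qed
qed

lemma skip_draws_coins: "\<omega> \<in> space coins \<Longrightarrow> skip_draws G \<omega> \<in> space coins"
  by (auto simp: space_coins skip_draws_def)

text \<open>The given program is correct for all weights and all random sequences, hence for each
  outcome of the noise separately.\<close>

lemma mechanism_correct:
  assumes A: "computes_mst_within A t" and G: "connected_graph G" and \<omega>: "\<omega> \<in> space coins"
  shows "halts_within (mechanism c A) G w \<omega> (16 + 11 * nedges G + t (nverts G) (nedges G))"
    and "minimum_spanning_tree G (noisy_weight c G w \<omega>) (tree_output (mechanism c A) G w \<omega>)"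
proof -
  have *: "halts_within A G (noisy_weight c G w \<omega>) (skip_draws G \<omega>) (t (nverts G) (nedges G))"
    "minimum_spanning_tree G (noisy_weight c G w \<omega>) (tree_output A G (noisy_weight c G w \<omega>) (skip_draws G \<omega>))"
    using A G skip_draws_coins[OF \<omega>] unfolding computes_mst_within_def by blast+
  show "halts_within (mechanism c A) G w \<omega> (16 + 11 * nedges G + t (nverts G) (nedges G))"
    by (rule halts_within_mechanism) (rule *)
  show "minimum_spanning_tree G (noisy_weight c G w \<omega>) (tree_output (mechanism c A) G w \<omega>)"
    using * by (simp only: tree_output_mechanism)
qed

lemma mechanism_spanning_tree:
  assumes "computes_mst_within A t" "connected_graph G" "\<omega> \<in> space coins"
  shows "spanning_tree G (tree_output (mechanism c A) G w \<omega>)"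
  using mechanism_correct(2)[OF assms] by (simp add: minimum_spanning_tree_def)

lemma mechanism_measurable:
  assumes "computes_mst_within A t" "connected_graph G"
  shows "tree_output (mechanism c A) G w \<in> measurable coins (count_space UNIV)"
proof (rule tree_output_measurable)
  fix \<omega> assume \<omega>: "\<omega> \<in> space coins"
  show "halts_within (mechanism c A) G w \<omega> (16 + 11 * nedges G + t (nverts G) (nedges G))"
    by (rule mechanism_correct(1)[OF assms \<omega>])
  show "tree_output (mechanism c A) G w \<omega> \<in> Pow (edges G)"
    using mechanism_spanning_tree[OF assms \<omega>] by (auto simp: spanning_tree_def)
qed (simp add: finite_edges)

text \<open>On a strict order the output is forced to be the greedy tree, whatever the given program
  does with its own random numbers.\<close>

lemma measure_release_mechanism:
  assumes A: "computes_mst_within A t" and G: "connected_graph G"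
    and \<sigma>: "\<sigma> = sqrt (nverts G) * c" "0 < \<sigma>"
  shows "measure (release (mechanism c A) G w) Z =
    kruskal_mean G (\<lambda>T. of_bool (T \<in> Z)) (\<lambda>e. exp (- w e / \<sigma>)) {} (edges G)"
proof -
  let ?f = "tree_output (mechanism c A) G w"
  have f: "?f \<in> measurable coins (count_space UNIV)" by (rule mechanism_measurable[OF A G])
  have "measure (release (mechanism c A) G w) Z = coins.prob (?f -` Z \<inter> space coins)"
    unfolding release_def by (rule measure_distr[OF f]) simp
  also have "\<dots> = kruskal_mean G (\<lambda>T. of_bool (T \<in> Z)) (\<lambda>e. exp (- w e / \<sigma>)) {} (edges G)"
    unfolding kruskal_mean_def
  proof (rule prob_by_race)
    show "?f -` Z \<inter> space coins \<in> sets coins" by (rule measurable_sets[OF f]) simp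
    fix p \<omega> assume p: "p \<in> permutations_of_set (edges G)" and \<omega>: "\<omega> \<in> space coins"
      and race: "race (\<lambda>e. exp (- w e / \<sigma>)) 0 p \<omega>"
    have "?f \<omega> = kruskal G {} p"
      using mst_eq_kruskal[OF G mechanism_correct(2)[OF A G \<omega>]] noisy_weight_sorted[OF \<sigma> race]
        permutations_of_setD(1)[OF p] by blast
    then show "\<omega> \<in> ?f -` Z \<inter> space coins \<longleftrightarrow> kruskal G {} p \<in> Z" using \<omega> by simp
  qed (simp_all add: finite_edges)
  finally show ?thesis .
qed

lemma neighboringD:
  assumes "neighboring G w w'" "e \<in> edges G"
  shows "\<bar>w e - w' e\<bar> \<le> 1"
proof -
  have "\<bar>w e - w' e\<bar> \<le> linf_dist G w w'"
    unfolding linf_dist_def using assms(2) finite_edges by (intro Max_ge) auto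
  then show ?thesis using assms(1) by (simp add: neighboring_def)
qed

text \<open>Changing a weight by at most 1 changes its rate by a factor of at most exp (1/\<sigma>);
  \<open>c\<close> is set so that 1/\<sigma> is the \<eta> of
  \<open>kruskal_mean_private\<close>.\<close>

lemma mechanism_private:
  assumes A: "computes_mst_within A t" and K: "0 < K" "0 < \<epsilon>" "0 < L" "\<epsilon> \<le> K * L"
    and c: "c = 2 * (K + 2) * sqrt L / \<epsilon>"
  shows "differentially_private \<epsilon> (exp (- L)) (mechanism c A)"
  unfolding differentially_private_def
proof (intro allI impI)
  fix G w w' Z assume G: "connected_graph G" and nb: "neighboring G w w'"
  define \<sigma> where "\<sigma> = sqrt (nverts G) * c"
  have n: "1 \<le> nverts G" "simple_graph G" using G by (auto simp: connected_graph_def)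
  have "0 < c" using K c by simp
  then have \<sigma>: "0 < \<sigma>" using n by (simp add: \<sigma>_def)
  have le: "exp (- x / \<sigma>) \<le> exp (1 / \<sigma>) * exp (- y / \<sigma>)" if "\<bar>x - y\<bar> \<le> 1" for x y
  proof -
    have "- x \<le> 1 - y" using that by linarith
    then have "- x / \<sigma> \<le> (1 - y) / \<sigma>" using \<sigma> by (intro divide_right_mono) auto
    then show ?thesis by (simp add: diff_divide_distrib flip: exp_add)
  qed
  show "measure (release (mechanism c A) G w) Z \<le> exp \<epsilon> * measure (release (mechanism c A) G w') Z + exp (- L)"
    unfolding measure_release_mechanism[OF A G \<sigma>_def \<sigma>]
  proof (rule kruskal_mean_private[where \<eta> = "1 / \<sigma>", OF n(2,1) _ _ _ _ _ _ K])
    fix e assume e: "e \<in> edges G"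
    have "\<bar>w e - w' e\<bar> \<le> 1" "\<bar>w' e - w e\<bar> \<le> 1"
      using neighboringD[OF nb e] by (simp_all add: abs_minus_commute)
    from le[OF this(1)] le[OF this(2)]
    show "exp (- w e / \<sigma>) \<le> exp (1 / \<sigma>) * exp (- w' e / \<sigma>)" "exp (- w' e / \<sigma>) \<le> exp (1 / \<sigma>) * exp (- w e / \<sigma>)" .
  next
    show "1 / \<sigma> = \<epsilon> / (2 * (K + 2) * sqrt L * sqrt (real (nverts G)))"
      by (simp add: \<sigma>_def c)
  qed simp_all
qed

section \<open>Expected error\<close>

lemma ln_neg_ln_le:
  assumes "0 \<le> u" "u \<le> (1::real)"
  shows "ln (- ln u) \<le> 2 * (1 / sqrt u)"
proof (cases "0 < u \<and> u < 1")
  case True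
  then have "ln (- ln u) \<le> - ln u - 1" by (intro ln_le_minus_one) simp
  \<comment> \<open>Halving the logarithm leads to 1 / sqrt u; the direct bound 1 / u would not be
    integrable.\<close>
  moreover have "- ln u = 2 * ln (1 / sqrt u)" using True by (simp add: ln_div ln_sqrt)
  moreover have "ln (1 / sqrt u) \<le> 1 / sqrt u - 1" using True by (intro ln_le_minus_one) simp
  ultimately show ?thesis by linarith
qed (use assms in auto)

text \<open>The bound stays logarithmic because it is going to be maximized over all edges, which
  then costs ln m.\<close>

lemma neg_ln_neg_ln_le:
  assumes "0 \<le> u" "u \<le> (1::real)"
  shows "- ln (- ln u) \<le> 2 * ln (1 / sqrt (1 - u))"
proof (cases "0 < u \<and> u < 1")
  case True
  then have "1 - u \<le> - ln u" using ln_le_minus_one[of u] by simp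
  then have "ln (1 - u) \<le> ln (- ln u)" using True by (intro ln_mono) auto
  then show ?thesis using True by (simp add: ln_div ln_sqrt)
qed (use assms in auto)

text \<open>The usual bound on an expected maximum, in pointwise form: the right side is independent
  of \<open>e\<close> and affine in \<open>q\<close>, so its expectation is immediate.\<close>

lemma ln_le_sum_div_card:
  fixes q :: "'a \<Rightarrow> real"
  assumes A: "finite A" "e \<in> A" and q: "\<And>a. a \<in> A \<Longrightarrow> 0 \<le> q a"
  shows "ln (q e) \<le> sum q A / card A + ln (card A)"
proof -
  have "0 < card A" using A by (auto simp: card_gt_0_iff)
  then have c: "1 \<le> real (card A)" by linarith
  have S: "q e \<le> sum q A" using A q by (intro member_le_sum) auto
  show ?thesis
  proof (cases "0 < q e")
    case True
    then have "ln (q e) \<le> ln (sum q A / card A * card A)" using S c by (intro ln_mono) auto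
    also have "\<dots> = ln (sum q A / card A) + ln (card A)" using True S c by (intro ln_mult_pos) auto
    also have "ln (sum q A / card A) \<le> sum q A / card A - 1" using True S c by (intro ln_le_minus_one) auto
    finally show ?thesis by simp
  next
    case False
    then have "q e = 0" using q A by fastforce
    then show ?thesis using c q by (simp add: sum_nonneg)
  qed
qed

text \<open>The tree \<open>T\<close> is fixed, so its noise can be averaged edge by edge. The tree
  \<open>T'\<close> depends on the noise, so each of its edges is charged the bound on the maximum;
  this is the origin of the logarithm.\<close>

lemma mst_perturbed_le:
  assumes G: "connected_graph G" and T: "minimum_spanning_tree G w T"
    and T': "minimum_spanning_tree G (noisy_weight c G w \<omega>) T'" and \<omega>: "\<omega> \<in> space coins"
    and \<sigma>: "\<sigma> = sqrt (nverts G) * c" "0 < \<sigma>"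
  shows "weight w T' \<le> weight w T + \<sigma> * ((\<Sum>e\<in>T. 2 * (1 / sqrt (\<omega> e))) +
    real (card T) * (2 * ((\<Sum>e\<in>edges G. 1 / sqrt (1 - \<omega> e)) / nedges G + ln (nedges G))))"
proof -
  let ?N = "\<lambda>e. ln (- ln (\<omega> e))" and ?b = "2 * ((\<Sum>e\<in>edges G. 1 / sqrt (1 - \<omega> e)) / nedges G + ln (nedges G))"
  have st: "spanning_tree G T" "spanning_tree G T'" using T T' by (auto simp: minimum_spanning_tree_def)
  have u: "0 \<le> \<omega> e" "\<omega> e \<le> 1" for e using \<omega> by (auto simp: space_coins)
  have split: "weight (noisy_weight c G w \<omega>) S = weight w S + \<sigma> * (\<Sum>e\<in>S. ?N e)" for S
    by (simp add: weight_def noisy_weight_def sum.distrib \<sigma>(1) sum_distrib_left mult.commute)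
  have "weight w T' + \<sigma> * (\<Sum>e\<in>T'. ?N e) \<le> weight w T + \<sigma> * (\<Sum>e\<in>T. ?N e)"
    using T' st(1) unfolding split[symmetric] minimum_spanning_tree_def by blast
  moreover have "(\<Sum>e\<in>T. ?N e) \<le> (\<Sum>e\<in>T. 2 * (1 / sqrt (\<omega> e)))"
    by (intro sum_mono ln_neg_ln_le u)
  moreover have "- (\<Sum>e\<in>T'. ?N e) \<le> real (card T) * ?b"
  proof -
    have "- ?N e \<le> ?b" if "e \<in> T'" for e
    proof -
      have "e \<in> edges G" using that st by (auto simp: spanning_tree_def)
      then have "ln (1 / sqrt (1 - \<omega> e)) \<le> (\<Sum>e\<in>edges G. 1 / sqrt (1 - \<omega> e)) / card (edges G) + ln (card (edges G))"
        using u by (intro ln_le_sum_div_card[OF finite_edges]) auto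
      with neg_ln_neg_ln_le[OF u, of e] show ?thesis by (simp add: edges_def)
    qed
    then have "(\<Sum>e\<in>T'. - ?N e) \<le> real (card T') * ?b"
      using sum_mono[of T' "\<lambda>e. - ?N e" "\<lambda>_. ?b"] by simp
    moreover have "card T' = card T" using card_spanning_tree[OF G st(1)] card_spanning_tree[OF G st(2)] by simp
    ultimately show ?thesis by (simp add: sum_negf)
  qed
  ultimately have "weight w T' \<le> weight w T + \<sigma> * (\<Sum>e\<in>T. ?N e) + \<sigma> * (- (\<Sum>e\<in>T'. ?N e))"
    and "\<sigma> * (\<Sum>e\<in>T. ?N e) \<le> \<sigma> * (\<Sum>e\<in>T. 2 * (1 / sqrt (\<omega> e)))"
    and "\<sigma> * (- (\<Sum>e\<in>T'. ?N e)) \<le> \<sigma> * (real (card T) * ?b)"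
    using \<sigma>(2) by (simp_all only: mult_le_cancel_left_pos)
  then show ?thesis by (simp only: distrib_left)
qed

lemma mechanism_expected_weight:
  assumes A: "computes_mst_within A t" and G: "connected_graph G" and T: "minimum_spanning_tree G w T"
    and \<sigma>: "\<sigma> = sqrt (nverts G) * c" "0 < \<sigma>"
  shows "(\<integral>T'. weight w T' \<partial>release (mechanism c A) G w) - weight w T
    \<le> \<sigma> * (real (card T) * (8 + 2 * ln (nedges G)))"
proof -
  let ?f = "tree_output (mechanism c A) G w" and ?m = "real (nedges G)"
  have f: "?f \<in> measurable coins (count_space UNIV)" by (rule mechanism_measurable[OF A G])
  define B where "B \<omega> = weight w T + \<sigma> * ((\<Sum>e\<in>T. 2 * (1 / sqrt (\<omega> e))) +
    real (card T) * (2 * ((\<Sum>e\<in>edges G. 1 / sqrt (1 - \<omega> e)) / ?m + ln ?m)))" for \<omega>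
  have const: "has_bochner_integral coins (\<lambda>_. a) a" for a :: real
    by (simp add: has_bochner_integral_iff coins.prob_space)
  have B: "has_bochner_integral coins B (weight w T + \<sigma> * ((\<Sum>e\<in>T. 2 * 2) +
    real (card T) * (2 * ((\<Sum>e\<in>edges G. 2) / ?m + ln ?m))))"
    unfolding B_def
    by (intro has_bochner_integral_add has_bochner_integral_mult_right has_bochner_integral_sum
        has_bochner_integral_divide const has_bochner_integral_coins
        has_bochner_integral_inverse_sqrt has_bochner_integral_inverse_sqrt_reflect)
  have int: "integrable coins (\<lambda>\<omega>. weight w (?f \<omega>))"
  proof (rule coins.integrable_const_bound[where B = "\<Sum>e\<in>edges G. \<bar>w e\<bar>"])
    show "AE \<omega> in coins. norm (weight w (?f \<omega>)) \<le> (\<Sum>e\<in>edges G. \<bar>w e\<bar>)"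
    proof (rule AE_I2)
      fix \<omega> assume "\<omega> \<in> space coins"
      then have "?f \<omega> \<subseteq> edges G" using mechanism_spanning_tree[OF A G] by (auto simp: spanning_tree_def)
      then have "(\<Sum>e\<in>?f \<omega>. \<bar>w e\<bar>) \<le> (\<Sum>e\<in>edges G. \<bar>w e\<bar>)"
        using finite_edges by (intro sum_mono2) auto
      then show "norm (weight w (?f \<omega>)) \<le> (\<Sum>e\<in>edges G. \<bar>w e\<bar>)"
        unfolding weight_def real_norm_def by (rule order_trans[OF sum_abs])
    qed
    show "(\<lambda>\<omega>. weight w (?f \<omega>)) \<in> borel_measurable coins"
      by (rule measurable_compose[OF f]) simp
  qed
  have "(\<integral>T'. weight w T' \<partial>release (mechanism c A) G w) = (\<integral>\<omega>. weight w (?f \<omega>) \<partial>coins)"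
    unfolding release_def by (rule integral_distr[OF f]) simp
  also have "\<dots> \<le> (\<integral>\<omega>. B \<omega> \<partial>coins)"
  proof (rule integral_mono)
    fix \<omega> assume \<omega>: "\<omega> \<in> space coins"
    show "weight w (?f \<omega>) \<le> B \<omega>"
      unfolding B_def by (rule mst_perturbed_le[OF G T mechanism_correct(2)[OF A G \<omega>] \<omega> \<sigma>])
  qed (use int B in \<open>auto simp: has_bochner_integral_iff\<close>)
  also have "\<dots> = weight w T + \<sigma> * ((\<Sum>e\<in>T. 2 * 2) + real (card T) * (2 * ((\<Sum>e\<in>edges G. 2) / ?m + ln ?m)))"
    using B by (simp only: has_bochner_integral_iff)
  also have "\<dots> \<le> weight w T + \<sigma> * (real (card T) * (8 + 2 * ln ?m))"
  proof -
    \<comment> \<open>Here \<open>x\<close> is the mean of the constant 2 over the edges: 2, or 0 if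
      there are no edges. Both trees contribute 2 * 2 per edge, whence the 8.\<close>
    have *: "x \<le> 2 \<Longrightarrow> 2 * 2 + 2 * (x + y) \<le> 8 + 2 * y" for x y :: real by simp
    have "(2::real) * 2 + 2 * ((\<Sum>e\<in>edges G. 2) / ?m + ln ?m) \<le> 8 + 2 * ln ?m"
      by (rule *) (simp add: edges_def)
    then have "real (card T) * (2 * 2 + 2 * ((\<Sum>e\<in>edges G. 2) / ?m + ln ?m)) \<le> real (card T) * (8 + 2 * ln ?m)"
      by (intro mult_left_mono) auto
    moreover have "(\<Sum>e\<in>T. 2 * 2) + real (card T) * z = real (card T) * (2 * 2 + z)" for z :: real
      by (simp add: distrib_left)
    ultimately show ?thesis using \<sigma>(2) by (simp only: add_left_mono mult_le_cancel_left_pos)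
  qed
  finally show ?thesis by linarith
qed

lemma mechanism_accurate:
  assumes A: "computes_mst_within A t" and G: "connected_graph G" and T: "minimum_spanning_tree G w T"
    and K: "0 < K" "0 < \<epsilon>" "0 < L" and c: "c = 2 * (K + 2) * sqrt L / \<epsilon>"
  shows "(\<integral>T'. weight w T' \<partial>release (mechanism c A) G w) - weight w T
    \<le> 40 * (K + 2) * (1 / \<epsilon> * real (nverts G) powr (3/2) * ln (nverts G) * sqrt L)"
proof -
  let ?n = "real (nverts G)"
  have n: "1 \<le> nverts G" "simple_graph G" using G by (auto simp: connected_graph_def)
  have c0: "0 < c" using K c by simp
  have st: "spanning_tree G T" using T by (simp add: minimum_spanning_tree_def)
  then have "T \<subseteq> edges G" by (simp add: spanning_tree_def)
  have card: "real (card T) = ?n - 1" using card_spanning_tree[OF G st] by linarith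
  \<comment> \<open>For n = 1 both sides vanish. Otherwise ln n \<ge> 2/3 gives 8 \<le> 12 ln n, and
    2 ln m \<le> 4 ln n, so 20 leaves some room.\<close>
  have bound: "real (card T) * (8 + 2 * ln (nedges G)) \<le> ?n * (20 * ln ?n)"
  proof (cases "nverts G = 1")
    case False
    then have n2: "2 \<le> ?n" using n by linarith
    have "card T \<le> nedges G" using card_mono[OF finite_edges \<open>T \<subseteq> edges G\<close>] by (simp add: edges_def)
    then have m: "1 \<le> real (nedges G)" using card n2 by linarith
    have "ln (nedges G) \<le> ln (?n ^ 2)"
      using m nedges_le[OF n(2)] by (intro ln_mono) (simp_all flip: of_nat_power)
    also have "\<dots> = 2 * ln ?n" using n2 by (simp add: ln_realpow)
    finally have "2 * ln (nedges G) \<le> 4 * ln ?n" by simp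
    moreover have "2 / 3 \<le> ln ?n" using ln2_ge_two_thirds ln_mono[OF n2] by linarith
    ultimately have "8 + 2 * ln (nedges G) \<le> 20 * ln ?n" by linarith
    then show ?thesis using card n2 m by (intro mult_mono) auto
  qed (use card in simp)
  have "(\<integral>T'. weight w T' \<partial>release (mechanism c A) G w) - weight w T
      \<le> (sqrt ?n * c) * (real (card T) * (8 + 2 * ln (nedges G)))"
    by (rule mechanism_expected_weight[OF A G T]) (use c0 n in simp_all)
  also have "\<dots> \<le> (sqrt ?n * c) * (?n * (20 * ln ?n))"
    using c0 bound by (intro mult_left_mono) auto
  also have "\<dots> = 40 * (K + 2) * (1 / \<epsilon> * (sqrt ?n * ?n) * ln ?n * sqrt L)"
    by (simp add: c)
  also have "sqrt ?n * ?n = ?n powr (3/2)"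
    using n powr_add[of ?n "1/2" 1] by (simp add: powr_half_sqrt)
  finally show ?thesis .
qed

theorem theorem1p1:
  shows "\<exists>c::nat. \<forall>K::real. K > 0 \<longrightarrow> (\<exists>C::real. C > 0 \<and>
    (\<forall>(\<epsilon>::real) (\<delta>::real) (t :: nat \<Rightarrow> nat \<Rightarrow> nat) (A :: program).
      \<epsilon> > 0 \<longrightarrow> 0 < \<delta> \<longrightarrow> \<delta> < 1 \<longrightarrow> \<epsilon> \<le> K * ln (1 / \<delta>) \<longrightarrow> computes_mst_within A t \<longrightarrow>
      (\<exists>M :: program.
         spanning_tree_mechanism M \<and>
         differentially_private \<epsilon> \<delta> M \<and>
         (\<forall>G w T. connected_graph G \<longrightarrow> minimum_spanning_tree G w T \<longrightarrow>
            (\<integral>T'. weight w T' \<partial>release M G w) - weight w T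
              \<le> C * (1 / \<epsilon> * real (nverts G) powr (3/2) * ln (real (nverts G)) * sqrt (ln (1 / \<delta>)))) \<and>
         (\<forall>G w. \<forall>\<omega>\<in>space coins. connected_graph G \<longrightarrow>
            halts_within M G w \<omega> (t (nverts G) (nedges G) + c * max 1 (nedges G))))))"
proof (rule exI[of _ 27], intro allI impI)
  fix K :: real assume K: "0 < K"
  show "\<exists>C::real. C > 0 \<and>
    (\<forall>(\<epsilon>::real) (\<delta>::real) (t :: nat \<Rightarrow> nat \<Rightarrow> nat) (A :: program).
      \<epsilon> > 0 \<longrightarrow> 0 < \<delta> \<longrightarrow> \<delta> < 1 \<longrightarrow> \<epsilon> \<le> K * ln (1 / \<delta>) \<longrightarrow> computes_mst_within A t \<longrightarrow>
      (\<exists>M :: program.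
         spanning_tree_mechanism M \<and>
         differentially_private \<epsilon> \<delta> M \<and>
         (\<forall>G w T. connected_graph G \<longrightarrow> minimum_spanning_tree G w T \<longrightarrow>
            (\<integral>T'. weight w T' \<partial>release M G w) - weight w T
              \<le> C * (1 / \<epsilon> * real (nverts G) powr (3/2) * ln (real (nverts G)) * sqrt (ln (1 / \<delta>)))) \<and>
         (\<forall>G w. \<forall>\<omega>\<in>space coins. connected_graph G \<longrightarrow>
            halts_within M G w \<omega> (t (nverts G) (nedges G) + 27 * max 1 (nedges G)))))"
  proof (rule exI[of _ "40 * (K + 2)"], intro conjI allI impI)
    fix \<epsilon> \<delta> :: real and t A
    assume \<epsilon>: "0 < \<epsilon>" and \<delta>: "0 < \<delta>" "\<delta> < 1" and \<epsilon>K: "\<epsilon> \<le> K * ln (1 / \<delta>)"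
      and A: "computes_mst_within A t"
    \<comment> \<open>The failure probability \<delta> becomes exp (- L). Neither \<open>L\<close>
      nor \<open>c\<close> depends on the graph.\<close>
    define L where "L = ln (1 / \<delta>)"
    define c where "c = 2 * (K + 2) * sqrt L / \<epsilon>"
    have L: "0 < L" "exp (- L) = \<delta>" using \<delta> by (simp_all add: L_def ln_div)
    show "\<exists>M :: program.
         spanning_tree_mechanism M \<and>
         differentially_private \<epsilon> \<delta> M \<and>
         (\<forall>G w T. connected_graph G \<longrightarrow> minimum_spanning_tree G w T \<longrightarrow>
            (\<integral>T'. weight w T' \<partial>release M G w) - weight w T
              \<le> 40 * (K + 2) * (1 / \<epsilon> * real (nverts G) powr (3/2) * ln (real (nverts G)) * sqrt (ln (1 / \<delta>)))) \<and>
         (\<forall>G w. \<forall>\<omega>\<in>space coins. connected_graph G \<longrightarrow>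
            halts_within M G w \<omega> (t (nverts G) (nedges G) + 27 * max 1 (nedges G)))"
    proof (rule exI[of _ "mechanism c A"], intro conjI allI ballI impI)
      show "spanning_tree_mechanism (mechanism c A)"
        unfolding spanning_tree_mechanism_def
        using mechanism_measurable[OF A] mechanism_correct(1)[OF A] mechanism_spanning_tree[OF A] by blast
      show "differentially_private \<epsilon> \<delta> (mechanism c A)"
        using mechanism_private[OF A K \<epsilon> L(1) _ c_def] \<epsilon>K L by (simp add: L_def)
    next
      fix G w T assume "connected_graph G" "minimum_spanning_tree G w T"
      then show "(\<integral>T'. weight w T' \<partial>release (mechanism c A) G w) - weight w T
          \<le> 40 * (K + 2) * (1 / \<epsilon> * real (nverts G) powr (3/2) * ln (real (nverts G)) * sqrt (ln (1 / \<delta>)))"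
        using mechanism_accurate[OF A _ _ K \<epsilon> L(1) c_def] unfolding L_def by blast
    next
      fix G w \<omega> assume "\<omega> \<in> space coins" "connected_graph G"
      \<comment> \<open>The overhead 16 + 11 m is at most 27 max 1 m; the maximum covers the graph
        without edges.\<close>
      then show "halts_within (mechanism c A) G w \<omega> (t (nverts G) (nedges G) + 27 * max 1 (nedges G))"
        by (intro halts_within_mono[OF mechanism_correct(1)[OF A]]) auto
    qed
  qed (use K in simp)
qed

end
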